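(* Let $G$ be a 2-connected $\{K_{1,3},W\}$-$o$-heavy graph. Then $\mathrm{cl}_c(G)$ is claw-free and $N$-$pq$-heavy.
   Context: All graphs are finite and simple. For a graph $G$ with $n=|V(G)|$ vertices, $d(v)$ and $N(v)$ denote the degree and neighborhood of $v$ in $G$. A vertex $v$ is heavy in $G$ if $d(v)\ge n/2$. A pair $\{u,v\}$ of nonadjacent vertices is an $o$-heavy pair of $G$ if $d(u)+d(v)\ge n$; a pair of adjacent vertices $\{u,v\}$ is an $a$-heavy pair of $G$ if $d(u)+d(v)\ge n$. For a graph $H$, $G$ is $H$-$o$-heavy if every induced subgraph of $G$ isomorphic to $H$ contains an $o$-heavy pair of $G$; $\{R,S\}$-$o$-heavy means both $R$-$o$-heavy and $S$-$o$-heavy. Claw-$o$-heavy means $K_{1,3}$-$o$-heavy. The wounded $W$ is the graph on vertices $x,y,z,p,q,r$ with edges $xy,yz,xz,yp,zq,qr$ (a triangle with a pendant edge at one vertex and a pendant path of length two at another). $c$-closure (Čada): let $G$ be claw-$o$-heavy on $n$ vertices and $x\in V(G)$. Let $E^{BC}_x=\{uv: u,v\in N(x), uv\notin E(G), d(u)+d(v)\ge n\}$ and $G^{BC}_x=(V(G),E(G)\cup E^{BC}_x)$. The vertex $x$ is $c$-eligible if $N(x)$ is not a clique in $G^{BC}_x$ and either (i) $G^{BC}_x[N(x)]$ is connected, or (ii) $G^{BC}_x[N(x)]$ is the disjoint union of two cliques $C_1,C_2$ and there is a vertex $z$ such that $\{x,z\}$ is an $o$-heavy pair of $G$ and $zy_1,zy_2\in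 E(G)$ for some $y_1\in C_1$, $y_2\in C_2$. The local $c$-completion $G^o_x$ is obtained from $G$ by adding all edges $uv$ with $u,v\in N(x)$, $uv\notin E(G)$. The $c$-closure $\mathrm{cl}_c(G)$ is obtained by recursively performing local $c$-completions at $c$-eligible vertices until no $c$-eligible vertex remains (the result is uniquely determined). The net $N$ has vertices $a_1,a_2,a_3,b_1,b_2,b_3$ and edges $a_1a_2,a_2a_3,a_1a_3,a_1b_1,a_2b_2,a_3b_3$. An induced net of a graph $G$ (labelled this way) is $p$-heavy if $\{a_1,a_2,a_3\}$ contains an $a$-heavy pair of $G$; it is $q$-heavy if there is $i\in\{1,2,3\}$ such that (i) $a_i,b_i$ are heavy in $G$; (ii) $d(a_j)=3$ and $d(b_j)=2$ for both $j\ne i$; (iii) for both $j\neq i$, the neighbor of $b_j$ other than $a_j$ is heavy in $G$. $G$ is $N$-$pq$-heavy if every induced net of $G$ is $p$-heavy or $q$-heavy (degrees taken in $G$).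
   Formalization: In the definition of a c-eligible vertex x, "N(x) is not a clique" is taken in G rather than in G^{BC}_x; with the latter, K_{3,3} has no c-eligible vertex, so it would be its own c-closure and contain claws, contradicting the claim. *)

theory Defs
  imports "Graph_Theory.Digraph_Isomorphism"
begin

text \<open>
  A finite simple graph is a \<^const>\<open>pair_graph\<close>: a finite vertex set with a symmetric,
  loop-free arc relation, an edge \<open>uv\<close> being the two arcs \<open>(u, v)\<close> and \<open>(v, u)\<close>.
\<close>

definition nbhd :: "'a pair_pre_digraph \<Rightarrow> 'a \<Rightarrow> 'a set" where
  "nbhd G v = {u. (v, u) \<in> parcs G}"

definition degree :: "'a pair_pre_digraph \<Rightarrow> 'a \<Rightarrow> nat" where
  "degree G v = card (nbhd G v)"

definition two_connected :: "'a pair_pre_digraph \<Rightarrow> bool" where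
  "two_connected G \<longleftrightarrow> card (pverts G) > 2 \<and> connected (with_proj G) \<and>
     (\<forall>v \<in> pverts G. connected (with_proj G \<restriction> (pverts G - {v})))"

definition is_clique :: "'a pair_pre_digraph \<Rightarrow> 'a set \<Rightarrow> bool" where
  "is_clique G S \<longleftrightarrow> (\<forall>u \<in> S. \<forall>v \<in> S. u \<noteq> v \<longrightarrow> (u, v) \<in> parcs G)"


subsection \<open>Heavy vertices and pairs\<close>

definition heavy :: "'a pair_pre_digraph \<Rightarrow> 'a \<Rightarrow> bool" where
  "heavy G v \<longleftrightarrow> v \<in> pverts G \<and> 2 * degree G v \<ge> card (pverts G)"

definition o_heavy_pair :: "'a pair_pre_digraph \<Rightarrow> 'a \<Rightarrow> 'a \<Rightarrow> bool" where
  "o_heavy_pair G u v \<longleftrightarrow> u \<in> pverts G \<and> v \<in> pverts G \<and> u \<noteq> v \<and> (u, v) \<notin> parcs G \<and>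
     degree G u + degree G v \<ge> card (pverts G)"

definition a_heavy_pair :: "'a pair_pre_digraph \<Rightarrow> 'a \<Rightarrow> 'a \<Rightarrow> bool" where
  "a_heavy_pair G u v \<longleftrightarrow> (u, v) \<in> parcs G \<and> degree G u + degree G v \<ge> card (pverts G)"


subsection \<open>Induced subgraphs\<close>

definition H_o_heavy :: "'b pair_pre_digraph \<Rightarrow> 'a pair_pre_digraph \<Rightarrow> bool" where
  "H_o_heavy H G \<longleftrightarrow>
     (\<forall>S \<subseteq> pverts G. digraph_iso (with_proj H) (with_proj G \<restriction> S) \<longrightarrow>
        (\<exists>u \<in> S. \<exists>v \<in> S. o_heavy_pair G u v))"

definition H_free :: "'b pair_pre_digraph \<Rightarrow> 'a pair_pre_digraph \<Rightarrow> bool" where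
  "H_free H G \<longleftrightarrow> \<not> (\<exists>S \<subseteq> pverts G. digraph_iso (with_proj H) (with_proj G \<restriction> S))"

definition from_edges :: "'a set \<Rightarrow> ('a \<times> 'a) set \<Rightarrow> 'a pair_pre_digraph" where
  "from_edges V E = \<lparr> pverts = V, parcs = E \<union> E\<inverse> \<rparr>"

definition claw :: "nat pair_pre_digraph" where
  "claw = from_edges {0, 1, 2, 3} {(0, 1), (0, 2), (0, 3)}"

text \<open>The vertices \<open>x, y, z, p, q, r\<close> of the wounded are numbered \<open>0, 1, 2, 3, 4, 5\<close>;
  the edges below are \<open>xy, yz, xz, yp, zq, qr\<close>.\<close>

definition wounded :: "nat pair_pre_digraph" where
  "wounded = from_edges {0, 1, 2, 3, 4, 5} {(0, 1), (1, 2), (0, 2), (1, 3), (2, 4), (4, 5)}"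


subsection \<open>The c-closure\<close>

definition bc_graph :: "'a pair_pre_digraph \<Rightarrow> 'a \<Rightarrow> 'a pair_pre_digraph" where
  "bc_graph G x = \<lparr> pverts = pverts G,
     parcs = parcs G \<union> {(u, v). u \<in> nbhd G x \<and> v \<in> nbhd G x \<and> o_heavy_pair G u v} \<rparr>"

text \<open>
  The requirement that the neighbourhood of \<open>x\<close> is not a clique refers to \<open>G\<close> itself, not to
  \<^term>\<open>bc_graph G x\<close>: otherwise no vertex of the complete bipartite graph with parts of size 3
  would be eligible, and that claw-o-heavy graph would be its own c-closure although it
  contains claws.
\<close>

definition c_eligible :: "'a pair_pre_digraph \<Rightarrow> 'a \<Rightarrow> bool" where
  "c_eligible G x \<longleftrightarrow> x \<in> pverts G \<and> \<not> is_clique G (nbhd G x) \<and>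
     (connected (with_proj (bc_graph G x) \<restriction> nbhd G x) \<or>
      (\<exists>C1 C2. C1 \<union> C2 = nbhd G x \<and> C1 \<inter> C2 = {} \<and>
         is_clique (bc_graph G x) C1 \<and> is_clique (bc_graph G x) C2 \<and>
         (\<forall>u \<in> C1. \<forall>v \<in> C2. (u, v) \<notin> parcs (bc_graph G x)) \<and>
         (\<exists>z. o_heavy_pair G x z \<and>
            (\<exists>y1 \<in> C1. \<exists>y2 \<in> C2. (z, y1) \<in> parcs G \<and> (z, y2) \<in> parcs G))))"

definition local_completion :: "'a pair_pre_digraph \<Rightarrow> 'a \<Rightarrow> 'a pair_pre_digraph" where
  "local_completion G x = \<lparr> pverts = pverts G,
     parcs = parcs G \<union> {(u, v). u \<in> nbhd G x \<and> v \<in> nbhd G x \<and> u \<noteq> v} \<rparr>"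

definition c_step :: "'a pair_pre_digraph \<Rightarrow> 'a pair_pre_digraph \<Rightarrow> bool" where
  "c_step G G' \<longleftrightarrow> (\<exists>x. c_eligible G x \<and> G' = local_completion G x)"

text \<open>
  \<open>is_c_closure G H\<close> holds if \<open>H\<close> is the outcome of some maximal sequence of local completions
  starting from \<open>G\<close>.
\<close>

definition is_c_closure :: "'a pair_pre_digraph \<Rightarrow> 'a pair_pre_digraph \<Rightarrow> bool" where
  "is_c_closure G H \<longleftrightarrow> c_step\<^sup>*\<^sup>* G H \<and> \<not> (\<exists>x. c_eligible H x)"


subsection \<open>Nets\<close>

text \<open>The net vertices \<open>a\<^sub>i\<close> and \<open>b\<^sub>i\<close> are \<open>Inl i\<close> and \<open>Inr i\<close>.\<close>

definition net :: "(nat + nat) pair_pre_digraph" where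
  "net = from_edges (Inl ` {1, 2, 3} \<union> Inr ` {1, 2, 3})
     {(Inl 1, Inl 2), (Inl 2, Inl 3), (Inl 1, Inl 3),
      (Inl 1, Inr 1), (Inl 2, Inr 2), (Inl 3, Inr 3)}"

definition induced_embedding :: "('b \<Rightarrow> 'a) \<Rightarrow> 'b pair_pre_digraph \<Rightarrow> 'a pair_pre_digraph \<Rightarrow> bool" where
  "induced_embedding f H G \<longleftrightarrow> inj_on f (pverts H) \<and> f ` pverts H \<subseteq> pverts G \<and>
     (\<forall>u \<in> pverts H. \<forall>v \<in> pverts H. (u, v) \<in> parcs H \<longleftrightarrow> (f u, f v) \<in> parcs G)"

definition induced_net :: "'a pair_pre_digraph \<Rightarrow> (nat \<Rightarrow> 'a) \<Rightarrow> (nat \<Rightarrow> 'a) \<Rightarrow> bool" where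
  "induced_net G a b \<longleftrightarrow> induced_embedding (case_sum a b) net G"

definition p_heavy_net :: "'a pair_pre_digraph \<Rightarrow> (nat \<Rightarrow> 'a) \<Rightarrow> (nat \<Rightarrow> 'a) \<Rightarrow> bool" where
  "p_heavy_net G a b \<longleftrightarrow> (\<exists>i \<in> {1, 2, 3}. \<exists>j \<in> {1, 2, 3}. a_heavy_pair G (a i) (a j))"

definition q_heavy_net :: "'a pair_pre_digraph \<Rightarrow> (nat \<Rightarrow> 'a) \<Rightarrow> (nat \<Rightarrow> 'a) \<Rightarrow> bool" where
  "q_heavy_net G a b \<longleftrightarrow>
     (\<exists>i \<in> {1, 2, 3}. heavy G (a i) \<and> heavy G (b i) \<and>
        (\<forall>j \<in> {1, 2, 3} - {i}. degree G (a j) = 3 \<and> degree G (b j) = 2 \<and>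
           (\<forall>w \<in> nbhd G (b j) - {a j}. heavy G w)))"

definition N_pq_heavy :: "'a pair_pre_digraph \<Rightarrow> bool" where
  "N_pq_heavy G \<longleftrightarrow> (\<forall>a b. induced_net G a b \<longrightarrow> p_heavy_net G a b \<or> q_heavy_net G a b)"


subsection \<open>Characterisation of induced copies, and existence of the c-closure\<close>

lemma digraph_iso_induce_iff:
  assumes H: "pair_wf_digraph H" and S: "S \<subseteq> pverts G"
  shows "digraph_iso (with_proj H) (with_proj G \<restriction> S) \<longleftrightarrow>
    (\<exists>f. induced_embedding f H G \<and> f ` pverts H = S)" (is "?L \<longleftrightarrow> ?R")
proof
  interpret H: pair_wf_digraph H by (rule H)
  {
    assume ?L
    then obtain h where h: "pre_digraph.digraph_isomorphism (with_proj H) h"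
      and eq: "with_proj G \<restriction> S = app_iso h (with_proj H)"
      by (auto simp: digraph_iso_def)
    have inj: "inj_on (iso_verts h) (pverts H)"
      using h by (simp add: pre_digraph.digraph_isomorphism_def)
    have V: "iso_verts h ` pverts H = S"
      using arg_cong[OF eq, of verts] by simp
    have A: "iso_arcs h ` parcs H = {e \<in> parcs G. fst e \<in> S \<and> snd e \<in> S}"
      using arg_cong[OF eq, of arcs] by simp
    have T: "iso_tail h = fst" "iso_head h = snd"
      using arg_cong[OF eq, of tail] arg_cong[OF eq, of head] by simp_all
    have im: "iso_arcs h (u, v) = (iso_verts h u, iso_verts h v)" if "(u, v) \<in> parcs H" for u v
      using h that T by (force simp: pre_digraph.digraph_isomorphism_def prod_eq_iff)
    have "(u, v) \<in> parcs H \<longleftrightarrow> (iso_verts h u, iso_verts h v) \<in> parcs G"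
      if uv: "u \<in> pverts H" "v \<in> pverts H" for u v
    proof
      assume "(u, v) \<in> parcs H"
      then show "(iso_verts h u, iso_verts h v) \<in> parcs G"
        using A im by (metis (mono_tags, lifting) imageI mem_Collect_eq)
    next
      assume "(iso_verts h u, iso_verts h v) \<in> parcs G"
      then have "(iso_verts h u, iso_verts h v) \<in> iso_arcs h ` parcs H"
        unfolding A using uv V by auto
      then obtain u' v' where uv': "(u', v') \<in> parcs H"
        and "(iso_verts h u, iso_verts h v) = (iso_verts h u', iso_verts h v')"
        using im by force
      then have "u = u'" "v = v'"
        using inj uv H.in_arcsD1[OF uv'] H.in_arcsD2[OF uv'] by (auto dest: inj_onD)
      then show "(u, v) \<in> parcs H" using uv' by simp
    qed
    then show ?R using inj V S by (auto simp: induced_embedding_def)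
  next
    assume ?R
    then obtain f where f: "induced_embedding f H G" and V: "f ` pverts H = S" by blast
    define h where "h = \<lparr> iso_verts = f, iso_arcs = map_prod f f, iso_head = snd, iso_tail = fst \<rparr>"
    have inj: "inj_on f (pverts H)" using f by (simp add: induced_embedding_def)
    have sub: "parcs H \<subseteq> pverts H \<times> pverts H"
      using H.in_arcsD1 H.in_arcsD2 by auto
    have "inj_on (map_prod f f) (parcs H)"
      using map_prod_inj_on[OF inj inj] sub by (rule inj_on_subset)
    then have iso: "pre_digraph.digraph_isomorphism (with_proj H) h"
      using inj H.wf_digraph by (auto simp: pre_digraph.digraph_isomorphism_def h_def)
    have "map_prod f f ` parcs H = {e \<in> parcs G. fst e \<in> S \<and> snd e \<in> S}" (is "?A = ?B")
    proof (intro set_eqI iffI)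
      fix e assume "e \<in> ?A"
      then show "e \<in> ?B" using f V sub by (auto simp: induced_embedding_def)
    next
      fix e assume "e \<in> ?B"
      then obtain u v where uv: "e = (f u, f v)" "u \<in> pverts H" "v \<in> pverts H" "e \<in> parcs G"
        using V by (cases e) auto
      then have "(u, v) \<in> parcs H" using f by (auto simp: induced_embedding_def)
      then show "e \<in> ?A" using uv(1) by force
    qed
    then have "with_proj G \<restriction> S = app_iso h (with_proj H)"
      using V by (simp add: induce_subgraph_def app_iso_def h_def)
    then show ?L using iso by (auto simp: digraph_iso_def)
  }
qed

lemma pair_graph_local_completion:
  assumes "pair_graph G"
  shows "pair_graph (local_completion G x)"
proof -
  interpret pair_graph G by fact
  have sub: "parcs (local_completion G x) \<subseteq> pverts G \<times> pverts G"
    by (auto simp: local_completion_def nbhd_def dest: in_arcsD1 in_arcsD2)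
  have fin: "finite (parcs (local_completion G x))"
    using sub pair_finite_verts by (meson finite_SigmaI finite_subset)
  show ?thesis
    using sub fin pair_finite_verts
    by unfold_locales
      (auto simp: local_completion_def nbhd_def symmetric_def sym_def
        dest: no_loops' arcs_symmetric)
qed

lemma ex_c_closure:
  assumes "pair_graph G"
  shows "\<exists>H. is_c_closure G H"
  using assms
proof (induction "card (pverts G \<times> pverts G - parcs G)" arbitrary: G rule: less_induct)
  case less
  interpret pair_graph G by fact
  show ?case
  proof (cases "\<exists>x. c_eligible G x")
    case False
    then show ?thesis by (auto simp: is_c_closure_def)
  next
    case True
    then obtain x where x: "c_eligible G x" by blast
    let ?G = "local_completion G x"
    from x obtain u v where uv: "u \<in> nbhd G x" "v \<in> nbhd G x" "u \<noteq> v" "(u, v) \<notin> parcs G"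
      by (auto simp: c_eligible_def is_clique_def)
    then have "(u, v) \<in> pverts G \<times> pverts G"
      by (auto simp: nbhd_def dest: in_arcsD2)
    with uv have "pverts ?G \<times> pverts ?G - parcs ?G \<subset> pverts G \<times> pverts G - parcs G"
      by (auto simp: local_completion_def)
    then have "card (pverts ?G \<times> pverts ?G - parcs ?G) < card (pverts G \<times> pverts G - parcs G)"
      using pair_finite_verts by (intro psubset_card_mono) auto
    then obtain H where "is_c_closure ?G H"
      using less.hyps pair_graph_local_completion[OF less.prems] by blast
    moreover have "c_step G ?G" using x by (auto simp: c_step_def)
    ultimately have "is_c_closure G H"
      by (auto simp: is_c_closure_def intro: converse_rtranclp_into_rtranclp)
    then show ?thesis by blast
  qed
qed

end

theory Submission
  imports Defs
begin

text \<open>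
  In the closure \<open>H\<close> no o-heavy pair is left, so \<open>H\<close> is claw-free and has no induced
  \<open>K\<^sub>4 - e\<close>; its maximal cliques (\<^emph>\<open>regions\<close>) meet pairwise in at most one vertex, and every
  vertex lies in one region (\<^emph>\<open>interior\<close>) or in two (\<^emph>\<open>frontier\<close>). Every o-heavy pair of \<open>G\<close> is
  an edge of \<open>H\<close> and has an interior common neighbour, whence the vertices of a region
  can be joined in \<open>G\<close> by paths with interior inner vertices.

  Let \<open>a\<^sub>i, b\<^sub>i\<close> be a net of \<open>H\<close> that is not p-heavy, let \<open>K\<close> be the region of the triangle and
  \<open>C\<^sub>i\<close> the region of \<open>a\<^sub>i b\<^sub>i\<close>. The interior vertices of \<open>K\<close> together with the \<open>a\<^sub>i\<close> contain no
  o-heavy pair of \<open>G\<close>, and excluding wounded graphs there shows that the \<open>a\<^sub>i\<close> form a triangle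
  of \<open>G\<close>. At most one \<open>a\<^sub>i\<close> is in an o-heavy pair of \<open>G\<close> inside \<open>C\<^sub>i\<close>. For each other \<open>i\<close>, further
  wounded graphs force \<open>C\<^sub>i = {a\<^sub>i, b\<^sub>i}\<close>,
      and the second neighbour of \<open>b\<^sub>i\<close> lies in the exceptional
  region \<open>C\<^sub>k\<close>, which contains more than half of the vertices: the net is q-heavy.
\<close>

section \<open>Regions of the closure\<close>

text \<open>The wounded and claw hypotheses speak about \<open>G\<close>, the nets live in
  \<open>H\<close>, and an edge of \<open>H\<close> may be missing in \<open>G\<close>. Degrees only
  grow towards \<open>H\<close>, so the bound given by the failure of p-heaviness passes down to
  \<open>G\<close>, and nonadjacency in \<open>H\<close> excludes both an edge and an o-heavy pair
  of \<open>G\<close>. In a would-be wounded graph most nonadjacent pairs are therefore settled in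
  \<open>H\<close>; the effort goes into finding its six edges in \<open>G\<close>. That only one
  index can be exceptional is a matter of counting. An o-heavy pair at \<open>a i\<close> within
  \<open>C i\<close> becomes an edge of \<open>H\<close>, so both degrees grow by at least one, and
  these two units give \<open>card (C j) + 2 <= card (C i)\<close>, which cannot hold both ways. The
  factor one half arises because the two degrees in \<open>G\<close> of an o-heavy pair at
  \<open>a k\<close> sum to at most \<open>2 * (card (C k) - 1)\<close>, while every vertex of the
  clique \<open>C k\<close> has degree at least \<open>card (C k) - 1\<close> in
  \<open>H\<close>.\<close>

definition heavy_nonadj :: "'a set \<Rightarrow> ('a \<Rightarrow> 'a \<Rightarrow> bool) \<Rightarrow> 'a \<Rightarrow> 'a \<Rightarrow> bool" where
  "heavy_nonadj V r u v \<longleftrightarrow> u \<in> V \<and> v \<in> V \<and> u \<noteq> v \<and> \<not> r u v \<and>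
     card V \<le> card {w. r u w} + card {w. r v w}"

definition adj_or_heavy :: "'a set \<Rightarrow> ('a \<Rightarrow> 'a \<Rightarrow> bool) \<Rightarrow> 'a \<Rightarrow> 'a \<Rightarrow> bool" where
  "adj_or_heavy V r u v \<longleftrightarrow> r u v \<or> heavy_nonadj V r u v"

text \<open>Stronger than maximality of a clique: an outside vertex has at most one neighbour in
  \<open>C\<close>, so two regions share at most one vertex. Without induced \<open>K4 - e\<close>
  it amounts to a maximal clique with at least two vertices.\<close>

definition region :: "('a \<Rightarrow> 'a \<Rightarrow> bool) \<Rightarrow> 'a set \<Rightarrow> bool" where
  "region r C \<longleftrightarrow> (\<exists>u\<in>C. \<exists>v\<in>C. u \<noteq> v) \<and> (\<forall>u\<in>C. \<forall>v\<in>C. u \<noteq> v \<longrightarrow> r u v) \<and>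
     (\<forall>u\<in>C. \<forall>v\<in>C. \<forall>w. u \<noteq> v \<longrightarrow> r w u \<longrightarrow> r w v \<longrightarrow> w \<in> C)"

text \<open>Distance from \<open>s\<close> in the graph induced on \<open>M\<close>, described by
  local rules; a shortest path is followed one predecessor at a time, so path lists never
  appear.\<close>

definition dist_from :: "('a \<Rightarrow> 'a \<Rightarrow> bool) \<Rightarrow> 'a set \<Rightarrow> 'a \<Rightarrow> ('a \<Rightarrow> nat) \<Rightarrow> bool" where
  "dist_from r M s d \<longleftrightarrow> d s = 0 \<and> (\<forall>x\<in>M. d x = 0 \<longrightarrow> x = s) \<and>
     (\<forall>x\<in>M. \<forall>y\<in>M. r x y \<longrightarrow> d y \<le> d x + 1) \<and>
     (\<forall>x\<in>M. x \<noteq> s \<longrightarrow> (\<exists>w\<in>M. r w x \<and> d x = d w + 1))"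

lemma dist_from_exists:
  assumes s: "s \<in> M"
    and cut: "\<And>A. A \<subseteq> M \<Longrightarrow> A \<noteq> {} \<Longrightarrow> A \<noteq> M \<Longrightarrow> \<exists>x\<in>A. \<exists>y\<in>M - A. r x y"
  shows "\<exists>d. dist_from r M s d"
proof -
  define R where "R = {(x, y). x \<in> M \<and> y \<in> M \<and> r x y}"
  define d where "d = (\<lambda>x. LEAST n. (s, x) \<in> R ^^ n)"
  define A where "A = {x \<in> M. (s, x) \<in> R\<^sup>*}"
  have "A = M"
  proof (rule ccontr)
    assume "A \<noteq> M"
    moreover have "A \<subseteq> M" "A \<noteq> {}" using s by (auto simp: A_def)
    ultimately obtain x y where "x \<in> A" "y \<in> M - A" "r x y" using cut by blast
    then show False by (auto simp: A_def R_def intro: rtrancl_into_rtrancl)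
  qed
  then have ex: "\<exists>n. (s, x) \<in> R ^^ n" if "x \<in> M" for x
    using that by (auto simp: A_def rtrancl_power)
  have d: "(s, x) \<in> R ^^ d x" if "x \<in> M" for x
    unfolding d_def using ex[OF that] by (rule LeastI_ex)
  have le: "d x \<le> n" if "(s, x) \<in> R ^^ n" for x n
    unfolding d_def using that by (rule Least_le)
  have 1: "d s = 0" using le[of s 0] by simp
  have 2: "x = s" if "x \<in> M" "d x = 0" for x using d[OF that(1)] that(2) by simp
  have 3: "d y \<le> d x + 1" if "x \<in> M" "y \<in> M" "r x y" for x y
    using le[of y "Suc (d x)"] d[OF that(1)] that by (auto simp: R_def)
  have 4: "\<exists>w\<in>M. r w x \<and> d x = d w + 1" if x: "x \<in> M" "x \<noteq> s" for x
  proof -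
    obtain m where m: "d x = Suc m" using 2[OF x(1)] x(2) by (cases "d x") auto
    then obtain w where w: "(s, w) \<in> R ^^ m" "(w, x) \<in> R" using d[OF x(1)] by auto
    then have "w \<in> M" "r w x" by (auto simp: R_def)
    moreover have "d w \<le> m" using le w by blast
    moreover have "d x \<le> d w + 1" using 3 \<open>w \<in> M\<close> \<open>r w x\<close> x by blast
    ultimately show ?thesis using m by force
  qed
  show ?thesis unfolding dist_from_def using 1 2 3 4 by blast
qed

text \<open>\<open>g\<close> is the original graph and \<open>h\<close> its closure on the same
  vertices. Connectedness enters only through crossing edges: \<open>region_cut\<close> for the
  subgraph of \<open>g\<close> induced on a region, \<open>two_conn\<close> after deleting a vertex.
  Distinctness is absent from \<open>wounded_g\<close>, since a coincidence among the six vertices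
  gives a loop or turns one of the nine pairs into an edge.\<close>

locale closure_pair =
  fixes V :: "'a set" and g h :: "'a \<Rightarrow> 'a \<Rightarrow> bool"
  assumes fin: "finite V"
    and g_sub: "g u v \<Longrightarrow> h u v"
    and g_sym: "g u v \<Longrightarrow> g v u"
    and h_sym: "h u v \<Longrightarrow> h v u"
    and h_irrefl: "\<not> h u u"
    and h_V: "h u v \<Longrightarrow> u \<in> V"
    and claw_g: "\<lbrakk>g x p; g x q; g x r; p \<noteq> q; p \<noteq> r; q \<noteq> r\<rbrakk> \<Longrightarrow>
      adj_or_heavy V g p q \<or> adj_or_heavy V g p r \<or> adj_or_heavy V g q r"
    and wounded_g: "\<lbrakk>g x y; g y z; g x z; g y p; g z q; g q r\<rbrakk> \<Longrightarrow>
      adj_or_heavy V g x p \<or> adj_or_heavy V g x q \<or> adj_or_heavy V g x r \<or>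
      adj_or_heavy V g y q \<or> adj_or_heavy V g y r \<or> adj_or_heavy V g z p \<or>
      adj_or_heavy V g z r \<or> adj_or_heavy V g p q \<or> adj_or_heavy V g p r"
    and h_closed: "\<not> heavy_nonadj V h u v"
    and claw_h: "\<lbrakk>h x p; h x q; h x r; p \<noteq> q; p \<noteq> r; q \<noteq> r\<rbrakk> \<Longrightarrow> h p q \<or> h p r \<or> h q r"
    and diamond_h: "\<lbrakk>h x y; h u x; h u y; h v x; h v y; u \<noteq> v\<rbrakk> \<Longrightarrow> h u v"
    and region_cut: "\<lbrakk>region h C; A \<subseteq> C; A \<noteq> {}; A \<noteq> C\<rbrakk> \<Longrightarrow> \<exists>x\<in>A. \<exists>y\<in>C - A. g x y"
    and two_conn: "\<lbrakk>v \<in> V; S \<subseteq> V - {v}; S \<noteq> {}; S \<noteq> V - {v}\<rbrakk> \<Longrightarrow>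
      \<exists>x\<in>S. \<exists>y\<in>V - {v} - S. g x y"
begin

abbreviation bc :: "'a \<Rightarrow> 'a \<Rightarrow> bool" where "bc \<equiv> adj_or_heavy V g"
abbreviation hv :: "'a \<Rightarrow> 'a \<Rightarrow> bool" where "hv \<equiv> heavy_nonadj V g"

definition span :: "'a \<Rightarrow> 'a \<Rightarrow> 'a set" where
  "span u v = {u, v} \<union> {w. h u w \<and> h v w}"

definition interior :: "'a set \<Rightarrow> 'a \<Rightarrow> bool" where
  "interior C x \<longleftrightarrow> x \<in> C \<and> (\<forall>y. h x y \<longrightarrow> y \<in> C)"

lemma finite_h: "finite {w. h u w}"
  using fin h_V h_sym by (metis (no_types, lifting) mem_Collect_eq rev_finite_subset subsetI)

lemma finite_g: "finite {w. g u w}"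
  using finite_h[of u] g_sub by (metis (no_types, lifting) mem_Collect_eq rev_finite_subset subsetI)

lemma deg_g_le_h: "card {w. g u w} \<le> card {w. h u w}"
  using finite_h g_sub by (intro card_mono) auto

lemma g_irrefl: "\<not> g u u"
  using g_sub h_irrefl by blast

lemma hv_sym: "hv u v \<Longrightarrow> hv v u"
  using g_sym by (auto simp: heavy_nonadj_def)

text \<open>Degrees do not shrink from \<open>g\<close> to \<open>h\<close>; a pair still
  nonadjacent in \<open>h\<close> would be o-heavy there, against \<open>h_closed\<close>.\<close>

lemma hv_imp_h: "hv u v \<Longrightarrow> h u v"
  using h_closed[of u v] deg_g_le_h[of u] deg_g_le_h[of v] by (auto simp: heavy_nonadj_def)

lemma bc_imp_h: "bc u v \<Longrightarrow> h u v"
  using hv_imp_h g_sub by (auto simp: adj_or_heavy_def)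

lemma region_adj: "region h C \<Longrightarrow> u \<in> C \<Longrightarrow> v \<in> C \<Longrightarrow> u \<noteq> v \<Longrightarrow> h u v"
  unfolding region_def by blast

lemma region_in: "region h C \<Longrightarrow> u \<in> C \<Longrightarrow> v \<in> C \<Longrightarrow> u \<noteq> v \<Longrightarrow> h w u \<Longrightarrow> h w v \<Longrightarrow> w \<in> C"
  unfolding region_def by blast

lemma region_sub: "region h C \<Longrightarrow> C \<subseteq> V"
  using h_V unfolding region_def by (metis subsetI)

lemma region_finite: "region h C \<Longrightarrow> finite C"
  using region_sub fin finite_subset by blast

section \<open>Regions as maximal cliques\<close>

lemma span_self: "u \<in> span u v" "v \<in> span u v"
  by (auto simp: span_def)

text \<open>Common neighbours of an edge are pairwise adjacent by \<open>diamond_h\<close>, and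
  applying it again shows that nothing outside sees two of these vertices. So every edge of
  \<open>h\<close> lies in a region.\<close>

lemma region_span:
  assumes "h u v" shows "region h (span u v)"
proof -
  have uv: "u \<noteq> v" using assms h_irrefl by auto
  have adj: "h x y" if "x \<in> span u v" "y \<in> span u v" "x \<noteq> y" for x y
    using that assms h_sym diamond_h[of u v x y] by (auto simp: span_def)
  have "w \<in> span u v" if "x \<in> span u v" "y \<in> span u v" "x \<noteq> y" "h w x" "h w y" for x y w
  proof -
    have "h s w" if "s \<in> {u, v}" "s \<noteq> w" for s
    proof -
      have s: "s \<in> span u v" using that by (auto simp: span_def)
      show ?thesis
        using diamond_h[of x y s w] adj[of x y] adj[of s x] adj[of s y] s that
          \<open>x \<in> span u v\<close> \<open>y \<in> span u v\<close> \<open>x \<noteq> y\<close> \<open>h w x\<close> \<open>h w y\<close> h_sym by blast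
    qed
    then show ?thesis by (auto simp: span_def)
  qed
  then have "\<forall>x\<in>span u v. \<forall>y\<in>span u v. \<forall>w. x \<noteq> y \<longrightarrow> h w x \<longrightarrow> h w y \<longrightarrow> w \<in> span u v"
    by blast
  moreover have "\<forall>x\<in>span u v. \<forall>y\<in>span u v. x \<noteq> y \<longrightarrow> h x y"
      using adj by blast
  moreover have "\<exists>x\<in>span u v. \<exists>y\<in>span u v. x \<noteq> y" using span_self uv by blast
  ultimately show ?thesis unfolding region_def by (intro conjI)
qed

lemma regions_eq:
  assumes "region h C" "region h D" "u \<in> C" "v \<in> C" "u \<in> D" "v \<in> D" "u \<noteq> v"
  shows "C = D"
proof -
  have "C \<subseteq> D" if "region h C" "region h D" "u \<in> C" "v \<in> C" "u \<in> D" "v \<in> D"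
      "u \<noteq> v" for C D
  proof
    fix x assume "x \<in> C"
    then show "x \<in> D"
      using region_in[OF that(2,5,6,7), of x] region_adj[OF that(1), of x] that by blast
  qed
  then show ?thesis using assms by blast
qed

lemma region_other: "region h C \<Longrightarrow> x \<in> C \<Longrightarrow> \<exists>t\<in>C. t \<noteq> x"
  unfolding region_def by metis

text \<open>Outside neighbours of \<open>x\<close> see nothing of \<open>C\<close> but
  \<open>x\<close>, so two nonadjacent ones and a further vertex of \<open>C\<close> would form a
  claw at \<open>x\<close>. Hence \<open>x\<close> lies in at most one region besides
  \<open>C\<close>.\<close>

lemma two_regions:
  assumes "region h C" "x \<in> C" "h x y" "h x z" "y \<notin> C" "z \<notin> C" "y \<noteq> z"
  shows "h y z"
proof -
  obtain t where t: "t \<in> C" "t \<noteq> x" using region_other assms by blast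
  have "h x t" using region_adj assms t by blast
  moreover have "\<not> h y t" "\<not> h z t"
    using region_in[OF assms(1) assms(2) t(1)] t assms h_sym by blast+
  moreover have "y \<noteq> t" "z \<noteq> t" using t assms by auto
  ultimately show ?thesis using claw_h[of x y z t] assms by blast
qed

section \<open>Frontier and interior vertices in the original graph\<close>

lemma region_g_nbr:
  assumes "region h C" "x \<in> C"
  shows "\<exists>y\<in>C. y \<noteq> x \<and> g x y"
  using region_cut[OF assms(1), of "{x}"] region_other[OF assms] assms(2) by blast

lemma frontier_g_nbr:
  assumes C: "region h C" "x \<in> C" and w: "h x w" "w \<notin> C"
  shows "\<exists>y\<in>span x w. y \<noteq> x \<and> g x y \<and> y \<notin> C"
proof -
  have r: "region h (span x w)" using region_span w by blast
  obtain y where y: "y \<in> span x w" "y \<noteq> x" "g x y"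
    using region_g_nbr[OF r span_self(1)] by blast
  then have "y \<notin> C"
    using regions_eq[OF C(1) r C(2) _ span_self(1), of y] w span_self(2) by blast
  then show ?thesis using y by blast
qed

text \<open>\<open>x\<close> has a \<open>g\<close>-neighbour outside \<open>C\<close>, nonadjacent
  in \<open>h\<close> to \<open>p\<close> and \<open>q\<close>; of the claw with these three leaves
  only the pair \<open>p\<close>, \<open>q\<close> can be \<open>bc\<close>.\<close>

lemma frontier_bc_clique:
  assumes C: "region h C" "x \<in> C" and w: "\<not> interior C x"
    and pq: "p \<in> C" "q \<in> C" "g x p" "g x q" "p \<noteq> q"
  shows "bc p q"
proof -
  obtain y where y: "g x y" "y \<notin> C"
    using frontier_g_nbr[OF C] w C(2) by (auto simp: interior_def)
  have ne: "x \<noteq> p" "x \<noteq> q" using pq g_irrefl by auto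
  have "\<not> h y p" "\<not> h y q"
    using region_in[OF C] ne pq y g_sub g_sym by blast+
  moreover have "y \<noteq> p" "y \<noteq> q" using y pq by auto
  ultimately show ?thesis
    using claw_g[of x y p q] y pq bc_imp_h by blast
qed

text \<open>
  The outside neighbours of distinct frontier common neighbours are distinct, and together with
  \<open>x\<close> and \<open>y\<close> they avoid \<open>N(x) \<union> N(y)\<close>; so not all common neighbours can be frontier.
\<close>

lemma hv_interior_nbr:
  assumes C: "region h C" "x \<in> C" "y \<in> C" and hv: "hv x y"
  shows "\<exists>z. interior C z \<and> g x z \<and> g y z"
proof (rule ccontr)
  assume no: "\<not> ?thesis"
  have xy: "x \<noteq> y" "\<not> g x y" and xV: "x \<in> V" "y \<in> V" using hv
      by (auto simp: heavy_nonadj_def)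
  let ?X = "{w. g x w}" and ?Y = "{w. g y w}"
  let ?K = "?X \<inter> ?Y"
  have KC: "?K \<subseteq> C" using region_in[OF C xy(1)] g_sub h_sym by blast
  have "\<exists>f. \<forall>c\<in>?K. h c (f c) \<and> f c \<notin> C"
    using no KC by (intro bchoice) (auto simp: interior_def)
  then obtain f where f: "\<And>c. c \<in> ?K \<Longrightarrow> h c (f c) \<and> f c \<notin> C" by blast
  have inj: "inj_on f ?K"
  proof (rule inj_onI, rule ccontr)
    fix c c' assume c: "c \<in> ?K" "c' \<in> ?K" "f c = f c'" "c \<noteq> c'"
    then have "f c \<in> C"
      using region_in[OF C(1), of c c' "f c"] KC f[of c] f[of c'] h_sym by auto
    then show False using f c by blast
  qed
  have sub: "f ` ?K \<union> {x, y} \<subseteq> V - (?X \<union> ?Y)"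
  proof -
    have "f c \<notin> ?X \<union> ?Y" if "c \<in> ?K" for c
      using region_in[OF C(1), of c x "f c"] region_in[OF C(1), of c y "f c"]
        f[OF that] that KC C g_sub h_sym g_irrefl by blast
    moreover have "f c \<in> V" if "c \<in> ?K" for c using f[OF that] h_V h_sym by blast
    ultimately show ?thesis using xV xy g_irrefl g_sym by blast
  qed
  \<comment> \<open>Heaviness leaves at most \<open>card ?K\<close> vertices outside both
    neighbourhoods; \<open>x\<close>, \<open>y\<close> and the images of \<open>f\<close> are two
    too many.\<close>
  have "card (f ` ?K \<union> {x, y}) = card ?K + 2"
  proof -
    have "f ` ?K \<inter> {x, y} = {}" using f C by blast
    then show ?thesis
      using card_image[OF inj] finite_g[of x] xy by (subst card_Un_disjoint) auto
  qed
  moreover have "card (f ` ?K \<union> {x, y}) \<le> card (V - (?X \<union> ?Y))"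
    using sub fin by (intro card_mono) auto
  moreover have "?X \<union> ?Y \<subseteq> V" using g_sub h_V h_sym by blast
  then have "card (V - (?X \<union> ?Y)) = card V - card (?X \<union> ?Y)"
      "card (?X \<union> ?Y) \<le> card V"
    using fin finite_g by (auto intro!: card_Diff_subset card_mono)
  moreover have "card ?X + card ?Y = card (?X \<union> ?Y) + card ?K"
    using card_Un_Int finite_g by blast
  moreover have "card V \<le> card ?X + card ?Y" using hv by (simp add: heavy_nonadj_def)
  ultimately show False by linarith
qed

text \<open>All neighbours of an interior vertex are in the clique \<open>R\<close>, where
  \<open>v\<close> sees just as many. This transfers degree bounds from the corners of a net to
  interior vertices.\<close>

lemma interior_deg_le:
  assumes R: "region h R" and u: "interior R u" and v: "v \<in> R"
  shows "card {w. h u w} \<le> card {w. h v w}"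
proof -
  have uR: "u \<in> R" using u unfolding interior_def by blast
  have f: "finite R" using region_finite[OF R] .
  have "{w. h u w} \<subseteq> R - {u}" using u h_irrefl unfolding interior_def by blast
  then have "card {w. h u w} \<le> card (R - {u})" using f by (intro card_mono) auto
  also have "\<dots> = card (R - {v})" using uR v f by simp
  also have "\<dots> \<le> card {w. h v w}"
    using region_adj[OF R v] finite_h[of v] by (intro card_mono) auto
  finally show ?thesis .
qed

text \<open>The pair itself is an edge of \<open>h\<close> but not of \<open>g\<close>. The extra
  unit at each end decides the count in \<open>heavy_index_card\<close>.\<close>

lemma hv_deg:
  assumes "hv u v" shows "card {w. g u w} + 1 \<le> card {w. h u w}"
proof -
  have uv: "h u v" "\<not> g u v" using hv_imp_h assms by (auto simp: heavy_nonadj_def)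
  then have "{w. g u w} \<subset> {w. h u w}" using g_sub by blast
  then have "card {w. g u w} < card {w. h u w}" using finite_h psubset_card_mono by blast
  then show ?thesis by simp
qed

text \<open>Frontier vertices are deleted from \<open>C\<close> one at a time, by induction on how
  many are missing. The \<open>g\<close>-neighbours in \<open>C\<close> of a deleted
  \<open>w\<close> are pairwise \<open>bc\<close>, and a merely o-heavy pair among them has an
  interior common neighbour, which is never deleted.\<close>

lemma interior_conn:
  assumes C: "region h C" and M: "M \<subseteq> C" "{x. interior C x} \<subseteq> M"
    and A: "A \<subseteq> M" "A \<noteq> {}" "A \<noteq> M"
  shows "\<exists>x\<in>A. \<exists>y\<in>M - A. g x y"
proof -
  have "\<forall>A. A \<subseteq> M \<longrightarrow> A \<noteq> {} \<longrightarrow> A \<noteq> M \<longrightarrow> (\<exists>x\<in>A. \<exists>y\<in>M - A. g x y)"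
    using M
  proof (induction "card (C - M)" arbitrary: M)
    case 0
    then have "M = C" using region_finite[OF C] by auto
    then show ?case using region_cut[OF C] by blast
  next
    case (Suc n)
    then obtain w where w: "w \<in> C - M" by (metis card.empty all_not_in_conv nat.distinct(1))
    then have fw: "\<not> interior C w" using Suc.prems by auto
    have "C - insert w M = (C - M) - {w}" by blast
    then have "card (C - insert w M) = n"
      using Suc.hyps(2) w region_finite[OF C] by simp
    then have IH: "\<And>A. A \<subseteq> insert w M \<Longrightarrow> A \<noteq> {} \<Longrightarrow> A \<noteq> insert w M \<Longrightarrow>
      \<exists>x\<in>A. \<exists>y\<in>insert w M - A. g x y"
      using Suc.hyps(1)[of "insert w M"] w Suc.prems by blast
    show ?case
    proof (intro allI impI)
      fix A assume A: "A \<subseteq> M" "A \<noteq> {}" "A \<noteq> M"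
      show "\<exists>x\<in>A. \<exists>y\<in>M - A. g x y"
      proof (rule ccontr)
        assume no: "\<not> ?thesis"
        have side: False if "p \<in> A" "q \<in> M - A" "g w p" "g w q" for p q
        proof -
          have pq: "p \<in> C" "q \<in> C" "p \<noteq> q" "w \<in> C" using that w A Suc.prems by auto
          then have "bc p q" using frontier_bc_clique[OF C _ fw] that by metis
          moreover have "\<not> g p q" using no that by blast
          ultimately have "hv p q" by (simp add: adj_or_heavy_def)
          then obtain z where z: "interior C z" "g p z" "g q z"
            using hv_interior_nbr[OF C pq(1,2)] by blast
          have "z \<in> M" "g z q" using Suc.prems(2) z g_sym[of q z] by auto
          then show False using no that z by (cases "z \<in> A") auto
        qed
        \<comment> \<open>By \<open>side\<close>, \<open>w\<close> has neighbours on one side of the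
          cut only. It is added to \<open>A\<close> exactly if they are there, so the crossing edge
          of the larger set avoids \<open>w\<close>.\<close>
        show False
        proof (cases "\<exists>p\<in>A. g w p")
          case True
          have wA: "insert w A \<noteq> insert w M" using A w by auto
          obtain x y where xy: "x \<in> insert w A" "y \<in> insert w M - insert w A" "g x y"
            using IH[OF _ _ wA] A(1) by (metis insert_mono insert_not_empty)
          then have "y \<in> M - A" by auto
          then show False using True side no xy by (cases "x = w") auto
        next
          case False
          have "A \<subseteq> insert w M" "A \<noteq> insert w M" using A w by auto
          then have "\<exists>x\<in>A. \<exists>y\<in>insert w M - A. g x y" using IH A(2) by metis
          then obtain x y where "x \<in> A" "y \<in> insert w M - A" "g x y" by blast
          then show False using False no g_sym[of x y] by auto
        qed
      qed
    qed
  qed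
  then show ?thesis using A by blast
qed

text \<open>The cut to cross is the closed neighbourhood of \<open>x\<close> within the interior
  vertices together with \<open>x\<close> and \<open>w\<close>. The resulting path \<open>x\<close>,
  \<open>p\<close>, \<open>q\<close> is induced in \<open>g\<close> and serves as a piece of a
  wounded graph.\<close>

lemma interior_two_step:
  assumes C: "region h C" and aw: "x \<in> C" "w \<in> C" "w \<noteq> x" "\<not> g x w"
  shows "\<exists>p q. interior C p \<and> (interior C q \<or> q = w) \<and> g x p \<and> g p q \<and> \<not> g x q \<and> q \<noteq> x"
proof -
  let ?M = "{z. interior C z} \<union> {x, w}"
  let ?A = "{x} \<union> {z \<in> ?M. g x z}"
  have "?M \<subseteq> C" using aw by (auto simp: interior_def)
  moreover have "?A \<noteq> ?M" using aw by blast
  ultimately obtain p q where "p \<in> ?A" "q \<in> ?M - ?A" "g p q"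
    using interior_conn[OF C, of ?M ?A] by blast
  then show ?thesis using aw g_irrefl by blast
qed

text \<open>Otherwise deleting \<open>x\<close> would separate the rest of \<open>C\<close> from
  \<open>w\<close>, against 2-connectedness.\<close>

lemma region_frontier:
  assumes C: "region h C" "x \<in> C" and w: "h x w" "w \<notin> C"
  shows "\<exists>f\<in>C. f \<noteq> x \<and> \<not> interior C f"
proof -
  have "C - {x} \<noteq> {}" using region_other[OF C] by blast
  moreover have "w \<in> V" "w \<noteq> x" using w h_V[OF h_sym] h_irrefl by auto
  then have "C - {x} \<noteq> V - {x}" using w by blast
  moreover have "C - {x} \<subseteq> V - {x}" "x \<in> V" using region_sub[OF C(1)] C(2) by auto
  ultimately obtain f y where "f \<in> C - {x}" "y \<in> V - {x} - (C - {x})" "g f y"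
    using two_conn[of x "C - {x}"] by blast
  then show ?thesis using g_sub[of f y] by (auto simp: interior_def)
qed

end

section \<open>Nets that are not p-heavy\<close>

text \<open>A permutation of the three indices: each lemma treats one arrangement and is reused for
  the others by renaming.\<close>

definition index_triple :: "nat \<Rightarrow> nat \<Rightarrow> nat \<Rightarrow> bool" where
  "index_triple i j k \<longleftrightarrow> {i, j, k} = {1, 2, 3}"

lemma index_triple_swap:
  "index_triple i j k \<Longrightarrow> index_triple j i k"
      "index_triple i j k \<Longrightarrow> index_triple i k j"
  by (simp_all add: index_triple_def insert_commute)

text \<open>Fixes the order of the facts cited below as \<open>t'(1)\<close> to
  \<open>t'(5)\<close>.\<close>

lemma index_triple_perms:
  assumes "index_triple i j k"
  shows "index_triple i k j" "index_triple j i k" "index_triple j k i" "index_triple k i j"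
    "index_triple k j i"
  using assms index_triple_swap by blast+

locale light_net = closure_pair +
  fixes a b :: "nat \<Rightarrow> 'a"
  assumes aa: "index_triple i j k \<Longrightarrow> h (a i) (a j)"
    and ab: "index_triple i j k \<Longrightarrow> h (a i) (b i)"
    and not_ab: "index_triple i j k \<Longrightarrow> \<not> h (a i) (b j)"
    and a_neq_b: "index_triple i j k \<Longrightarrow> a i \<noteq> b j"
    and not_bb: "index_triple i j k \<Longrightarrow> \<not> h (b i) (b j)"
    and b_neq: "index_triple i j k \<Longrightarrow> b i \<noteq> b j"
    and light: "index_triple i j k \<Longrightarrow> card {w. h (a i) w} + card {w. h (a j) w} < card V"
begin

section \<open>Regions around a net\<close>

definition K :: "'a set" where "K = span (a 1) (a 2)"

definition C :: "nat \<Rightarrow> 'a set" where "C i = span (a i) (b i)"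

text \<open>The part of \<open>K\<close> where every degree in \<open>h\<close> is dominated by that
  of a corner. Other frontier vertices are left out because nothing bounds their degrees.\<close>

definition M :: "'a set" where "M = {x. interior K x} \<union> {a 1, a 2, a 3}"

lemma triple_123: "index_triple 1 2 3"
  by (simp add: index_triple_def)

lemma triple_cases:
  assumes "index_triple i j k" shows "i = 1 \<or> i = 2 \<or> i = 3"
  using assms unfolding index_triple_def by blast

lemma a_neq: "index_triple i j k \<Longrightarrow> a i \<noteq> a j"
  using aa h_irrefl by metis

lemma K_region: "region h K"
  unfolding K_def using region_span aa[OF triple_123] .

lemma a_in_K: assumes "index_triple i j k" shows "a i \<in> K"
proof -
  have "h (a 1) (a 3)" "h (a 2) (a 3)"
    using aa index_triple_perms[OF triple_123] by blast+
  then show ?thesis using triple_cases[OF assms] by (auto simp: K_def span_def)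
qed

lemma C_region: "index_triple i j k \<Longrightarrow> region h (C i)"
  unfolding C_def using region_span ab .

lemma a_in_C: "a i \<in> C i" and b_in_C: "b i \<in> C i"
  by (auto simp: C_def span_self)

lemma a_neq_b_same: "index_triple i j k \<Longrightarrow> a i \<noteq> b i"
  using ab h_irrefl by metis

lemma b_notin_K:
  assumes t: "index_triple i j k" shows "b i \<notin> K"
  using region_adj[OF K_region a_in_K[OF index_triple_perms(2)[OF t]], of "b i"]
    not_ab[OF index_triple_perms(2)[OF t]] a_neq_b[OF index_triple_perms(2)[OF t]] by blast

lemma C_Int_K:
  assumes t: "index_triple i j k" and x: "x \<in> C i" "x \<in> K" shows "x = a i"
proof (rule ccontr)
  assume "x \<noteq> a i"
  then have "C i = K"
    using regions_eq[OF C_region[OF t] K_region x(1) a_in_C x(2) a_in_K[OF t]] by blast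
  then show False using b_notin_K[OF t] b_in_C[of i] by simp
qed

lemma C_not_adj:
  assumes t: "index_triple i j k" and x: "x \<in> C i" "x \<noteq> a i"
  shows "\<not> h x (a j)" "\<not> h (a j) x" "x \<noteq> a j" "x \<notin> K"
proof -
  show n: "x \<notin> K" using C_Int_K[OF t x(1)] x(2) by blast
  have "h x (a i)" using region_adj[OF C_region[OF t] x(1) a_in_C x(2)] .
  then show "\<not> h x (a j)"
    using region_in[OF K_region a_in_K[OF t] a_in_K[OF index_triple_perms(2)[OF t]] a_neq[OF t]] n
    by blast
  then show "\<not> h (a j) x" using h_sym by blast
  show "x \<noteq> a j" using n a_in_K[OF index_triple_perms(2)[OF t]] by blast
qed

lemma C_disjoint:
  assumes t: "index_triple i j k" and x: "x \<in> C i" shows "x \<notin> C j"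
proof
  assume xj: "x \<in> C j"
  have "h x (a j) \<or> x = a j"
    using region_adj[OF C_region[OF index_triple_perms(2)[OF t]] xj a_in_C] by blast
  then have "x = a i" using C_not_adj[OF t x] by blast
  then have "a i \<in> C j" using xj by simp
  then have "h (a i) (b j)"
    using region_adj[OF C_region[OF index_triple_perms(2)[OF t]] _ b_in_C] a_neq_b[OF t] by blast
  then show False using not_ab[OF t] by blast
qed

lemma nbr_a:
  assumes t: "index_triple i j k" and x: "h (a i) x" shows "x \<in> K \<or> x \<in> C i"
proof (rule ccontr)
  assume n: "\<not> ?thesis"
  then have "x \<noteq> b i" using b_in_C by blast
  then have "h x (b i)"
    using two_regions[OF K_region a_in_K[OF t] x ab[OF t]] n b_notin_K[OF t] by blast
  then have "x \<in> C i"
    using region_in[OF C_region[OF t] a_in_C b_in_C a_neq_b_same[OF t]] x h_sym by blast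
  then show False using n by blast
qed

lemma a_frontier_K: "index_triple i j k \<Longrightarrow> \<not> interior K (a i)"
  using ab b_notin_K unfolding interior_def by blast

lemma a_frontier_C:
  assumes t: "index_triple i j k" shows "\<not> interior (C i) (a i)"
  using aa[OF t] C_disjoint[OF index_triple_perms(2)[OF t] a_in_C] unfolding interior_def by blast

lemma outer_nbr:
  assumes t: "index_triple i j k" obtains w where "w \<in> C i" "w \<noteq> a i" "g (a i) w"
  using region_g_nbr[OF C_region[OF t] a_in_C] by blast

lemma C_K_not_adj:
  assumes t: "index_triple i j k" and x: "x \<in> C i" "x \<noteq> a i" and z: "z \<in> K" "z \<noteq> a i"
  shows "\<not> h x z" "\<not> h z x"
proof -
  have "h x (a i)" using region_adj[OF C_region[OF t] x(1) a_in_C x(2)] .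
  then show "\<not> h x z"
    using region_in[OF K_region z(1) a_in_K[OF t] z(2)] C_Int_K[OF t x(1)] x(2) by blast
  then show "\<not> h z x" using h_sym by blast
qed

lemma M_sub_K: "M \<subseteq> K"
  using a_in_K[OF triple_123] a_in_K[OF index_triple_perms(2)[OF triple_123]]
    a_in_K[OF index_triple_perms(4)[OF triple_123]] unfolding M_def interior_def by auto

lemma a_in_M: "index_triple i j k \<Longrightarrow> a i \<in> M"
  using triple_cases unfolding M_def by blast

lemma interior_in_M: "interior K x \<Longrightarrow> x \<in> M"
  unfolding M_def by blast

section \<open>The corners form a triangle of the original graph\<close>

lemma M_cases:
  assumes t: "index_triple i j k" and x: "x \<in> M"
  shows "interior K x \<or> x = a i \<or> x = a j \<or> x = a k"
proof -
  have "{1, 2, 3} = {i, j, k}" using t by (simp add: index_triple_def)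
  then have "a ` {1, 2, 3} = a ` {i, j, k}" by simp
  then show ?thesis using x unfolding M_def by auto
qed

lemma M_conn: "A \<subseteq> M \<Longrightarrow> A \<noteq> {} \<Longrightarrow> A \<noteq> M \<Longrightarrow> \<exists>x\<in>A. \<exists>y\<in>M - A. g x y"
  using interior_conn[OF K_region M_sub_K] unfolding M_def by blast

text \<open>Two distinct corners can be chosen that dominate \<open>u\<close> and \<open>v\<close>
  in degree, since an interior vertex is dominated by every corner; \<open>light\<close> then bounds
  the degree sum.\<close>

lemma M_not_hv:
  assumes "u \<in> M" "v \<in> M" shows "\<not> hv u v"
proof
  assume hv: "hv u v"
  then have ne: "u \<noteq> v" by (simp add: heavy_nonadj_def)
  have dom: "\<exists>i j k. index_triple i j k \<and> card {w. h u w} \<le> card {w. h (a i) w} \<and>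
    card {w. h v w} \<le> card {w. h (a j) w}"
  proof -
    have int: "card {w. h x w} \<le> card {w. h (a i) w}" if "interior K x" "index_triple i j k" for x i j k
      using interior_deg_le[OF K_region that(1) a_in_K[OF that(2)]] .
    note p = triple_123 index_triple_perms[OF triple_123]
    have other: "\<exists>i j k. index_triple i j k \<and> card {w. h x w} \<le> card {w. h (a i) w} \<and>
        card {w. h (a m) w} \<le> card {w. h (a j) w}" if "interior K x" "index_triple m m' m''" for x m m' m''
      using int[OF that(1) index_triple_perms(2)[OF that(2)]] index_triple_perms(2)[OF that(2)] by blast
    have both: ?thesis if "interior K u" "interior K v"
      using int[OF that(1) p(1)] int[OF that(2) p(3)] p(1) by blast
    consider "interior K u" "interior K v" | i j k where "interior K u" "v = a i" "index_triple i j k"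
      | i j k where "u = a i" "interior K v" "index_triple i j k"
      | i j k where "u = a i" "v = a j" "index_triple i j k"
      using M_cases[OF triple_123 assms(1)] M_cases[OF triple_123 assms(2)] ne p by metis
    then show ?thesis
    proof cases
      case 1 then show ?thesis using both by blast
    next
      case (2 i j k) then show ?thesis using other by blast
    next
      case (3 i j k)
      then show ?thesis using int[OF _ index_triple_perms(2)[OF 3(3)]] by blast
    next
      case (4 i j k) then show ?thesis by blast
    qed
  qed
  then obtain i j k where t: "index_triple i j k" and
    "card {w. h u w} \<le> card {w. h (a i) w}" "card {w. h v w} \<le> card {w. h (a j) w}" by blast
  moreover have "card V \<le> card {w. g u w} + card {w. g v w}"
    using hv by (simp add: heavy_nonadj_def)
  ultimately show False
    using light[OF t] deg_g_le_h[of u] deg_g_le_h[of v] by linarith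
qed

lemma M_bc: "u \<in> M \<Longrightarrow> v \<in> M \<Longrightarrow> bc u v \<Longrightarrow> g u v"
  using M_not_hv unfolding adj_or_heavy_def by blast

lemma M_claw:
  "\<lbrakk>g x p; g x q; g x r; p \<in> M; q \<in> M; r \<in> M; p \<noteq> q; p \<noteq> r; q \<noteq> r\<rbrakk> \<Longrightarrow> g p q \<or> g p r \<or> g q r"
  using claw_g[of x p q r] M_bc by blast

lemma M_simplicial:
  assumes t: "index_triple i j k" and "g (a i) p" "g (a i) q" "p \<in> M" "q \<in> M" "p \<noteq> q"
  shows "g p q"
proof -
  have "p \<in> K" "q \<in> K" using assms M_sub_K by blast+
  then show ?thesis
    using frontier_bc_clique[OF K_region a_in_K[OF t] a_frontier_K[OF t]] assms M_bc by blast
qed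

text \<open>\<open>v\<close> has at most one neighbour in \<open>C i\<close>, so \<open>a i\<close>
  has a single \<open>g\<close>-neighbour there, and it is frontier. A further vertex of
  \<open>C i\<close> would require an interior first step by \<open>interior_two_step\<close>. This
  converts adjacency forced by wounded graphs into small regions.\<close>

lemma only_nbr:
  assumes t: "index_triple i j k" and v: "v \<notin> C i"
    and adj: "\<And>w. w \<in> C i \<Longrightarrow> w \<noteq> a i \<Longrightarrow> g (a i) w \<Longrightarrow> h v w"
  shows "C i = {a i, b i} \<and> h v (b i)"
proof -
  obtain w where w: "w \<in> C i" "w \<noteq> a i" "g (a i) w" using outer_nbr[OF t] by blast
  have uniq: "w' = w" if "w' \<in> C i" "w' \<noteq> a i" "g (a i) w'" for w'
    using region_in[OF C_region[OF t] w(1) that(1)] v adj[OF w] adj[OF that] by blast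
  have front: "\<not> interior (C i) w" using adj[OF w] v h_sym unfolding interior_def by blast
  have "C i = {a i, w}"
  proof (rule ccontr)
    assume "\<not> ?thesis"
    then obtain x where x: "x \<in> C i" "x \<noteq> a i" "x \<noteq> w" using a_in_C w by blast
    then have "\<not> g (a i) x" using uniq by blast
    then obtain p where p: "interior (C i) p" "g (a i) p"
      using interior_two_step[OF C_region[OF t] a_in_C x(1,2)] by blast
    then have "p \<in> C i" "p \<noteq> a i" using g_irrefl unfolding interior_def by blast+
    then show False using uniq p front by blast
  qed
  moreover have "b i \<in> C i" using b_in_C .
  ultimately have "b i = w" using a_neq_b_same[OF t] by auto
  then show ?thesis using \<open>C i = {a i, w}\<close> adj[OF w] by simp
qed

text \<open>Triangle \<open>q\<close>, \<open>y\<close>, \<open>x\<close>; the pendant path leaves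
  \<open>x\<close> towards \<open>a i\<close> and the pendant edge leaves \<open>y\<close> towards
  \<open>a j\<close>. Where the geodesic ends too early it is prolonged into \<open>C i\<close> or
  \<open>C j\<close>; \<open>D3\<close> ensures that at most one prolongation is needed.\<close>

lemma long_wounded:
  assumes t: "index_triple i j k"
    and d1: "dist_from g M (a i) d1" and d2: "dist_from g M (a j) d2"
    and D: "\<And>z. z \<in> M \<Longrightarrow> D \<le> d1 z + d2 z" and D3: "D \<ge> 3"
    and qM: "q \<in> M" and xM: "x \<in> M" and yM: "y \<in> M"
    and qx: "g q x" and qy: "g q y" and xy: "g x y"
    and x: "d1 x + d2 x = D" and y: "d1 y + d2 y = D" and yx: "d1 y = d1 x + 1"
    and x1: "d1 x \<ge> 1" and q: "d1 q + d2 q > D"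
  shows False
proof -
  have s1: "d1 v \<le> d1 u + 1" "d1 u \<le> d1 v + 1" "d2 v \<le> d2 u + 1" "d2 u \<le> d2 v + 1"
    if "g u v" "u \<in> M" "v \<in> M" for u v
    using d1 d2 that g_sym[OF that(1)] unfolding dist_from_def by blast+
  have e1: "\<exists>w\<in>M. g w z \<and> d1 z = d1 w + 1" if "z \<in> M" "z \<noteq> a i" for z
    using d1 that unfolding dist_from_def by blast
  have e2: "\<exists>w\<in>M. g w z \<and> d2 z = d2 w + 1" if "z \<in> M" "z \<noteq> a j" for z
    using d2 that unfolding dist_from_def by blast
  have z1: "z = a i" if "z \<in> M" "d1 z = 0" for z using d1 that unfolding dist_from_def by blast
  have za: "d1 (a i) = 0" "d2 (a j) = 0" using d1 d2 unfolding dist_from_def by blast+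
  \<comment> \<open>Distances change by at most one along an edge. This settles nonadjacency within
    \<open>M\<close>; prolongation vertices are handled by \<open>C_K_not_adj\<close>.\<close>
  have far: "\<not> bc u v" if "u \<in> M" "v \<in> M"
      "d1 u > d1 v + 1 \<or> d1 v > d1 u + 1 \<or> d2 u > d2 v + 1 \<or> d2 v > d2 u + 1" for u v
    using M_bc[OF that(1,2)] s1[OF _ that(1,2)] that(3) by force
  obtain p where p: "p \<in> M" "g p x" "d1 x = d1 p + 1" using e1[OF xM] x1 za by force
  have p2: "d2 p = d2 x + 1" using s1[OF p(2,1) xM] D[OF p(1)] x p(3) by linarith
  \<comment> \<open>Being off the geodesics but adjacent to both \<open>x\<close> and
    \<open>y\<close>, the vertex \<open>q\<close> is as far from \<open>a i\<close> as
    \<open>y\<close> and as far from \<open>a j\<close> as \<open>x\<close>.\<close>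
  have dq: "d1 q \<ge> d1 x + 1" "d2 q \<ge> d2 x"
    using s1[OF qx qM xM] s1[OF qy qM yM] q x y yx by linarith+
  have nqp: "\<not> bc q p" using far[OF qM p(1)] dq p by linarith
  have nyp: "\<not> bc y p" using far[OF yM p(1)] p yx by linarith
  have qa: "q \<noteq> a i" "x \<noteq> a i" "y \<noteq> a i" using dq za x1 yx by auto
  have sub: "q \<in> K" "x \<in> K" "y \<in> K" "p \<in> K" using qM xM yM p(1) M_sub_K by blast+
  show False
  proof (cases "d1 x = 1")
    case True
    have pa: "p = a i" using z1[OF p(1)] p True by simp
    obtain r where r: "r \<in> C i" "r \<noteq> a i" "g (a i) r" using outer_nbr[OF t] by blast
    have "y \<noteq> a j" using y yx True D3 za by auto
    then obtain y1 where y1: "y1 \<in> M" "g y1 y" "d2 y = d2 y1 + 1" using e2[OF yM] by blast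
    have dy1: "d1 y1 = d1 y + 1" using s1[OF y1(2,1) yM] D[OF y1(1)] y y1(3) by linarith
    have ny: "\<not> bc q y1" "\<not> bc x y1" "\<not> bc y1 p"
      using far[OF qM y1(1)] far[OF xM y1(1)] far[OF y1(1) p(1)] dq x y yx dy1 y1(3) p(3) p2 by linarith+
    have y1a: "y1 \<noteq> a i" using dy1 za by auto
    have "y1 \<in> K" using y1 M_sub_K by blast
    then have nr: "\<not> bc q r" "\<not> bc y r" "\<not> bc x r" "\<not> bc y1 r"
      using C_K_not_adj[OF t r(1,2)] sub qa y1a bc_imp_h by blast+
    show False
      using wounded_g[of q y x y1 p r] qx qy xy y1(2) p(2) r(3) nqp nyp ny nr g_sym pa by blast
  next
    case False
    then have "p \<noteq> a i" using p x1 za by auto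
    then obtain r where r: "r \<in> M" "g r p" "d1 p = d1 r + 1" using e1[OF p(1)] by blast
    have r2: "d2 r = d2 p + 1" using s1[OF r(2,1) p(1)] D[OF r(1)] x p(3) p2 r(3) by linarith
    have nr: "\<not> bc q r" "\<not> bc y r" "\<not> bc x r"
      using far[OF qM r(1)] far[OF yM r(1)] far[OF xM r(1)] dq x y yx p(3) r(3) by linarith+
    show False
    proof (cases "y = a j")
      case True
      obtain s where s: "s \<in> C j" "s \<noteq> a j" "g (a j) s"
        using outer_nbr[OF index_triple_perms(2)[OF t]] by blast
      have ne: "q \<noteq> a j" "x \<noteq> a j" "p \<noteq> a j" "r \<noteq> a j"
        using True qy xy g_irrefl p2 r2 za by auto
      have "r \<in> K" using r M_sub_K by blast
      then have "\<not> bc q s" "\<not> bc x s" "\<not> bc s p" "\<not> bc s r"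
        using C_K_not_adj[OF index_triple_perms(2)[OF t] s(1,2)] sub ne bc_imp_h by blast+
      then show False
        using wounded_g[of q y x s p r] qx qy xy s(3) p(2) r(2) nqp nyp nr g_sym True by blast
    next
      case False
      then obtain s where s: "s \<in> M" "g s y" "d2 y = d2 s + 1" using e2[OF yM] by blast
      have ds: "d1 s = d1 y + 1" using s1[OF s(2,1) yM] D[OF s(1)] y s(3) by linarith
      have "\<not> bc q s" "\<not> bc x s" "\<not> bc s p" "\<not> bc s r"
        using far[OF qM s(1)] far[OF xM s(1)] far[OF s(1) p(1)] far[OF s(1) r(1)]
          dq x y yx ds s(3) p(3) r(3) p2 by linarith+
      then show False
        using wounded_g[of q y x s p r] qx qy xy s(2) p(2) r(2) nqp nyp nr g_sym by blast
    qed
  qed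
qed

text \<open>
  A vertex \<open>q\<close> hanging on the set of all shortest \<open>a i\<close>--\<open>a j\<close> paths forms a triangle with two
  consecutive vertices of such a path; if the distance is at least 3, this triangle and the path,
  prolonged into \<open>C i\<close> or \<open>C j\<close>, contain a wounded graph. Such a \<open>q\<close> exists since \<open>a k\<close> is simplicial
  and hence on no such path.
\<close>

lemma dist_le_two:
  assumes t: "index_triple i j k"
  shows "g (a i) (a j) \<or> (\<exists>p\<in>M. g (a i) p \<and> g p (a j))"
proof (rule ccontr)
  assume no: "\<not> ?thesis"
  note t' = index_triple_perms[OF t]
  have aM: "a i \<in> M" "a j \<in> M" "a k \<in> M" using a_in_M t t' by blast+
  obtain d1 d2 where d1: "dist_from g M (a i) d1" and d2: "dist_from g M (a j) d2"
    using dist_from_exists[OF aM(1) M_conn] dist_from_exists[OF aM(2) M_conn] by metis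
  have s1: "d1 v \<le> d1 u + 1" "d1 u \<le> d1 v + 1" "d2 v \<le> d2 u + 1" "d2 u \<le> d2 v + 1"
    if "g u v" "u \<in> M" "v \<in> M" for u v
    using d1 d2 that g_sym[OF that(1)] unfolding dist_from_def by blast+
  have e1: "\<exists>w\<in>M. g w z \<and> d1 z = d1 w + 1" if "z \<in> M" "z \<noteq> a i" for z
    using d1 that unfolding dist_from_def by blast
  have e2: "\<exists>w\<in>M. g w z \<and> d2 z = d2 w + 1" if "z \<in> M" "z \<noteq> a j" for z
    using d2 that unfolding dist_from_def by blast
  have z1: "z = a i" if "z \<in> M" "d1 z = 0" for z using d1 that unfolding dist_from_def by blast
  have z2: "z = a j" if "z \<in> M" "d2 z = 0" for z using d2 that unfolding dist_from_def by blast
  have za: "d1 (a i) = 0" "d2 (a j) = 0" using d1 d2 unfolding dist_from_def by blast+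
  \<comment> \<open>\<open>dist_from\<close> does not provide symmetry; the triangle inequalities
    \<open>D\<close> and \<open>D'\<close>, proved by walking to either end, yield
    \<open>d2 (a i) = d1 (a j)\<close>.\<close>
  define D where "D = d1 (a j)"
  have D: "D \<le> d1 z + d2 z" if "z \<in> M" for z
    using that
  proof (induction "d2 z" arbitrary: z)
    case 0 then show ?case using z2[of z] by (simp add: D_def)
  next
    case (Suc n)
    then have "z \<noteq> a j" using za by auto
    then obtain w where w: "w \<in> M" "g w z" "d2 z = d2 w + 1" using e2[OF Suc.prems] by blast
    then have "D \<le> d1 w + d2 w" using Suc by simp
    then show ?case using s1[OF w(2,1) Suc.prems] w(3) by linarith
  qed
  have D': "d2 (a i) \<le> d1 z + d2 z" if "z \<in> M" for z
    using that
  proof (induction "d1 z" arbitrary: z)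
    case 0 then show ?case using z1[of z] by simp
  next
    case (Suc n)
    then have "z \<noteq> a i" using za by auto
    then obtain w where w: "w \<in> M" "g w z" "d1 z = d1 w + 1" using e1[OF Suc.prems] by blast
    then have "d2 (a i) \<le> d1 w + d2 w" using Suc by simp
    then show ?case using s1[OF w(2,1) Suc.prems] w(3) by linarith
  qed
  have Da: "d2 (a i) = D" using D[OF aM(1)] D'[OF aM(2)] za D_def by linarith
  have D3: "D \<ge> 3"
  proof -
    obtain w where w: "w \<in> M" "g w (a j)" "D = d1 w + 1"
      using e1[OF aM(2)] a_neq[OF t'(2)] D_def by auto
    then have wi: "w \<noteq> a i" using no by blast
    then obtain u where u: "u \<in> M" "g u w" "d1 w = d1 u + 1" using e1[OF w(1)] by blast
    then have "u \<noteq> a i" using no w by blast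
    then have "d1 u \<noteq> 0" using z1[OF u(1)] by blast
    then show ?thesis using u w by linarith
  qed
  have triangle: False
    if q: "q \<in> M" "d1 q + d2 q > D" and u: "u \<in> M" "d1 u + d2 u = D" and v: "v \<in> M"
        "d1 v + d2 v = D"
      and "g q u" "g q v" "g u v" and uv: "d1 v = d1 u + 1" for q u v
  proof (cases "d1 u = 0")
    case False
    show False
      using long_wounded[OF t d1 d2 D D3 q(1) u(1) v(1) \<open>g q u\<close> \<open>g q v\<close> \<open>g u v\<close> u(2) v(2) uv _ q(2)]
        False by simp
  next
    \<comment> \<open>Here \<open>u\<close> is \<open>a i\<close>, which leaves no room for the path
      on this side. Since \<open>D\<close> is at least 3, the roles of \<open>a i\<close> and
      \<open>a j\<close> can be exchanged.\<close>
    case True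
    have "d2 v \<ge> 1" "d2 u = d2 v + 1" using True u v uv D3 by linarith+
    then show False
      using long_wounded[OF t'(2) d2 d1 _ D3 q(1) v(1) u(1) \<open>g q v\<close> \<open>g q u\<close> g_sym[OF \<open>g u v\<close>]]
        D u(2) v(2) q(2) by (metis add.commute)
  qed
  have succ: "\<exists>w\<in>M. g w s \<and> d2 s = d2 w + 1 \<and> d1 w = d1 s + 1" if sM: "s \<in> M"
      "s \<noteq> a j" "d1 s + d2 s = D" for s
  proof -
    obtain w where w: "w \<in> M" "g w s" "d2 s = d2 w + 1" using e2[OF sM(1,2)] by blast
    then show ?thesis using s1[OF w(2,1) sM(1)] D[OF w(1)] sM(3) by force
  qed
  have pred: "\<exists>w\<in>M. g w s \<and> d1 s = d1 w + 1 \<and> d2 w = d2 s + 1" if sM: "s \<in> M"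
      "s \<noteq> a i" "d1 s + d2 s = D" for s
  proof -
    obtain w where w: "w \<in> M" "g w s" "d1 s = d1 w + 1" using e1[OF sM(1,2)] by blast
    then show ?thesis using s1[OF w(2,1) sM(1)] D[OF w(1)] sM(3) by force
  qed
  let ?S = "{z \<in> M. d1 z + d2 z = D}"
  have "a k \<notin> ?S"
  proof
    assume k: "a k \<in> ?S"
    obtain u v where u: "u \<in> M" "g u (a k)" "d1 (a k) = d1 u + 1" and
      v: "v \<in> M" "g v (a k)" "d1 v = d1 (a k) + 1"
      using pred[OF aM(3)] succ[OF aM(3)] k a_neq t' by blast
    then have "u \<noteq> v" by auto
    then have "g u v" using M_simplicial[OF t'(4)] u v g_sym by blast
    then show False using s1[OF _ u(1) v(1)] u v by force
  qed
  moreover have "a i \<in> ?S" using aM Da za by simp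
  ultimately obtain s q where s: "s \<in> M" "d1 s + d2 s = D" and q: "q \<in> M"
      "d1 q + d2 q \<noteq> D" "g s q"
    using M_conn[of ?S] aM by blast
  have qD: "d1 q + d2 q > D" using D[OF q(1)] q(2) by linarith
  have qs: "g q s" using g_sym q by blast
  consider "s = a i" | "s = a j" | "s \<noteq> a i" "s \<noteq> a j" by blast
  then show False
  proof cases
    case 1
    then have "s \<noteq> a j" using a_neq[OF t] by simp
    then obtain w where w: "w \<in> M" "g w s" "d2 s = d2 w + 1" "d1 w = d1 s + 1"
      using succ[OF s(1) _ s(2)] by blast
    have "w \<noteq> q" using w qD s by auto
    then have "g q w" using M_simplicial[OF t, of q w] 1 q w g_sym by blast
    then show False using triangle[OF q(1) qD s w(1) _ qs _ g_sym[OF w(2)]] w s by linarith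
  next
    case 2
    then have "s \<noteq> a i" using a_neq[OF t'(2)] by simp
    then obtain w where w: "w \<in> M" "g w s" "d1 s = d1 w + 1" "d2 w = d2 s + 1"
      using pred[OF s(1) _ s(2)] by blast
    have "w \<noteq> q" using w qD s by auto
    then have "g q w" using M_simplicial[OF t'(2), of q w] 2 q w g_sym by blast
    then show False using triangle[OF q(1) qD w(1) _ s _ qs w(2)] w s by linarith
  next
    case 3
    obtain w where w: "w \<in> M" "g w s" "d2 s = d2 w + 1" "d1 w = d1 s + 1"
      using succ[OF s(1) _ s(2)] 3 by blast
    obtain u where u: "u \<in> M" "g u s" "d1 s = d1 u + 1" "d2 u = d2 s + 1"
      using pred[OF s(1) _ s(2)] 3 by blast
    have "w \<noteq> q" "u \<noteq> q" "u \<noteq> w" using w u qD s by auto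
    moreover have "\<not> g u w" using s1[OF _ u(1) w(1)] u w by force
    ultimately have "g q u \<or> g q w"
      using M_claw[of s q u w] q w u g_sym by blast
    then show False
      using triangle[OF q(1) qD s w(1) _ qs _ g_sym[OF w(2)]]
        triangle[OF q(1) qD u(1) _ s _ qs u(2)] w u s by linarith
  qed
qed

text \<open>Triangle \<open>a k\<close>, \<open>a i\<close>, \<open>p\<close>, a pendant edge from
  \<open>a i\<close> into \<open>C i\<close>, and a path from \<open>p\<close> over
  \<open>a j\<close> into \<open>C j\<close>: only the two end vertices can be \<open>bc\<close>. So
  the outer \<open>g\<close>-neighbours of \<open>a i\<close> and \<open>a j\<close> are mutually
  adjacent in \<open>h\<close>, and \<open>only_nbr\<close> applied on both sides makes
  \<open>b i\<close>, \<open>b j\<close> adjacent.\<close>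

lemma kite_contradiction:
  assumes t: "index_triple i j k" and n: "\<not> g (a i) (a j)" "g (a i) (a k)" "\<not> g (a k) (a j)"
    and p: "p \<in> M" "g (a i) p" "g p (a j)"
  shows False
proof -
  note t' = index_triple_perms[OF t]
  have aM: "a i \<in> M" "a j \<in> M" "a k \<in> M" using a_in_M t t' by blast+
  have pk: "p \<noteq> a k" "p \<noteq> a i" "p \<noteq> a j" using n p g_irrefl by blast+
  have gpk: "g (a k) p" using M_simplicial[OF t n(2) p(2) aM(3) p(1)] pk by blast
  have pK: "p \<in> K" using p M_sub_K by blast
  have adj: "h u v" if u: "u \<in> C i" "u \<noteq> a i" "g (a i) u" and v: "v \<in> C j"
      "v \<noteq> a j" "g (a j) v" for u v
  proof -
    have "\<not> bc (a k) u" "\<not> bc (a k) v" "\<not> bc (a i) v" "\<not> bc p u" "\<not> bc p v"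
        "\<not> bc u (a j)"
      using C_not_adj[OF t u(1,2)] C_not_adj[OF t'(1) u(1,2)] C_not_adj[OF t'(2) v(1,2)]
        C_not_adj[OF t'(3) v(1,2)] C_K_not_adj[OF t u(1,2) pK pk(2)]
        C_K_not_adj[OF t'(2) v(1,2) pK pk(3)] bc_imp_h by blast+
    moreover have "\<not> bc (a k) (a j)" "\<not> bc (a i) (a j)" using M_bc aM n by blast+
    ultimately have "bc u v"
      using wounded_g[of "a k" "a i" p u "a j" v] g_sym[OF n(2)] p gpk u(3) v(3) by blast
    then show ?thesis using bc_imp_h by blast
  qed
  have "h v (b i)" if v: "v \<in> C j" "v \<noteq> a j" "g (a j) v" for v
    using only_nbr[OF t C_disjoint[OF t'(2) v(1)]] adj[OF _ _ _ v] h_sym by blast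
  then have "h (b i) (b j)"
    using only_nbr[OF t'(2) C_disjoint[OF t b_in_C]] h_sym by blast
  then show False using not_bb[OF t] by blast
qed

text \<open>The cases count to how many of \<open>a i\<close>, \<open>a j\<close> the corner
  \<open>a k\<close> is adjacent. Two contradict \<open>M_simplicial\<close>, one is the kite, and
  none leaves two different midpoints \<open>p\<close>, \<open>q\<close> that form with
  \<open>a i\<close> the triangle of a wounded graph.\<close>

lemma net_triangle:
  assumes t: "index_triple i j k" shows "g (a i) (a j)"
proof (rule ccontr)
  assume n: "\<not> ?thesis"
  note t' = index_triple_perms[OF t]
  have aM: "a i \<in> M" "a j \<in> M" "a k \<in> M" using a_in_M t t' by blast+
  obtain p where p: "p \<in> M" "g (a i) p" "g p (a j)" using dist_le_two[OF t] n by blast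
  have nj: "\<not> g (a j) (a i)" using n g_sym by blast
  consider "g (a i) (a k)" "g (a k) (a j)" | "g (a i) (a k)" "\<not> g (a k) (a j)"
    | "\<not> g (a k) (a i)" "g (a j) (a k)" | "\<not> g (a i) (a k)" "\<not> g (a k) (a j)"
    using g_sym by blast
  then show False
  proof cases
    case 1
    then show False
      using M_simplicial[OF t'(4), of "a i" "a j"] aM a_neq[OF t] n g_sym by blast
  next
    case 2
    then show False using kite_contradiction[OF t n 2 p] by blast
  next
    case 3
    then show False
      using kite_contradiction[OF t'(2) nj 3(2,1) p(1)] p g_sym by blast
  next
    case 4
    obtain q where q: "q \<in> M" "g (a i) q" "g q (a k)" using dist_le_two[OF t'(1)] 4 by blast
    have npk: "\<not> g p (a k)"
      using M_claw[of p "a i" "a j" "a k"] p aM a_neq[OF t] a_neq[OF t'(1)] a_neq[OF t'(3)] 4 n g_sym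
      by blast
    have nqj: "\<not> g q (a j)"
      using M_claw[of q "a i" "a j" "a k"] q aM a_neq[OF t] a_neq[OF t'(1)] a_neq[OF t'(3)] 4 n g_sym
      by blast
    have "p \<noteq> q" using npk q by blast
    then have pq: "g q p" using M_simplicial[OF t q(2) p(2) q(1) p(1)] by blast
    obtain r where r: "r \<in> C j" "r \<noteq> a j" "g (a j) r" using outer_nbr[OF t'(2)] by blast
    have ne: "p \<noteq> a j" "q \<noteq> a j" using p(3) nqj q(3) 4 p(2) q(2) n g_irrefl by blast+
    have "p \<in> K" "q \<in> K" using p q M_sub_K by blast+
    then have "\<not> bc (a i) r" "\<not> bc q r" "\<not> bc p r" "\<not> bc (a k) r"
      using C_not_adj[OF t'(2) r(1,2)] C_not_adj[OF t'(3) r(1,2)] C_K_not_adj[OF t'(2) r(1,2)] ne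
        bc_imp_h by blast+
    moreover have "\<not> bc (a i) (a k)" "\<not> bc (a i) (a j)" "\<not> bc q (a j)" "\<not> bc p (a k)"
        "\<not> bc (a k) (a j)"
      using M_bc aM p(1) q(1) n 4 npk nqj by blast+
    ultimately show False
      using wounded_g[of "a i" q p "a k" "a j" r] q p pq r(3) by blast
  qed
qed

text \<open>The triangle of corners carries the path \<open>p\<close>, \<open>q\<close> at
  \<open>a i\<close> and the pendant vertex \<open>w\<close> at \<open>a j\<close>; the conclusion
  lists the only pairs not already excluded.\<close>

lemma tripod:
  assumes t: "index_triple i j k" and p: "p \<in> C i" "p \<noteq> a i" "g (a i) p" and pq: "g p q"
    and q: "\<not> h q (a j)" "\<not> h q (a k)" and w: "w \<in> C j" "w \<noteq> a j" "g (a j) w"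
  shows "bc (a i) q \<or> bc w p \<or> bc w q"
proof -
  note t' = index_triple_perms[OF t]
  have "\<not> bc (a k) w" "\<not> bc (a i) w" "\<not> bc (a k) p" "\<not> bc (a j) p"
      "\<not> bc (a k) q" "\<not> bc (a j) q"
    using C_not_adj[OF t'(3) w(1,2)] C_not_adj[OF t'(2) w(1,2)] C_not_adj[OF t p(1,2)]
      C_not_adj[OF t'(1) p(1,2)] q h_sym bc_imp_h by blast+
  then show ?thesis
    using wounded_g[of "a k" "a j" "a i" w p q] net_triangle[OF t'(5)] net_triangle[OF t'(2)]
      net_triangle[OF t'(4)] p(3) pq w(3) by blast
qed

section \<open>Corners with and without an o-heavy pair in their outer region\<close>

definition heavy_index :: "nat \<Rightarrow> bool" where
    "heavy_index i \<longleftrightarrow> (\<exists>p\<in>C i. hv (a i) p)"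

text \<open>In \<open>h\<close> the degrees of \<open>a i\<close> and \<open>p\<close> sum to at
  least \<open>card V + 2\<close>, and they have at most \<open>card (C i) - 2\<close> common
  neighbours, so they jointly miss at most \<open>card (C i) - 4\<close> vertices. Among those
  missed is all of \<open>C j\<close> except \<open>a j\<close> and at most one neighbour of
  \<open>p\<close>.\<close>

lemma heavy_index_card:
  assumes t: "index_triple i j k" and "heavy_index i" shows "card (C j) + 2 \<le> card (C i)"
proof -
  note t' = index_triple_perms[OF t]
  obtain p where p: "p \<in> C i" "hv (a i) p" using assms(2) unfolding heavy_index_def by blast
  have pa: "p \<noteq> a i" using p by (auto simp: heavy_nonadj_def)
  let ?A = "{w. h (a i) w}" and ?P = "{w. h p w}"
  have Cf: "finite (C i)" "finite (C j)" using region_finite C_region t t' by blast+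
  have "?A \<inter> ?P \<subseteq> C i - {a i, p}"
    using region_in[OF C_region[OF t] a_in_C p(1) pa[symmetric]] h_sym h_irrefl by blast
  then have 1: "card (?A \<inter> ?P) \<le> card (C i) - 2"
    using card_mono[of "C i - {a i, p}" "?A \<inter> ?P"] Cf p(1) pa a_in_C[of i]
    by (simp add: card_Diff_subset)
  have 2: "card (C j \<inter> ?P) \<le> 1"
  proof -
    have "u = v" if "u \<in> C j \<inter> ?P" "v \<in> C j \<inter> ?P" for u v
      using region_in[OF C_region[OF t'(2)], of u v p] that C_disjoint[OF t p(1)] by blast
    then show ?thesis using Cf card_le_Suc0_iff_eq[of "C j \<inter> ?P"] by auto
  qed
  have "C j - {a j} - ?P \<subseteq> V - (?A \<union> ?P)"
    using C_not_adj[OF t'(2)] region_sub[OF C_region[OF t'(2)]] by blast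
  then have "card (C j - {a j} - ?P) \<le> card (V - (?A \<union> ?P))" using fin by (intro card_mono) auto
  moreover have "card (C j) - 2 \<le> card (C j - {a j} - ?P)"
  proof -
    have "C j = (C j - {a j} - ?P) \<union> (C j \<inter> ?P) \<union> {a j}" using a_in_C[of j] by blast
    then have "card (C j) \<le> card ((C j - {a j} - ?P) \<union> (C j \<inter> ?P)) + card {a j}"
      by (metis card_Un_le)
    also have "\<dots> \<le> card (C j - {a j} - ?P) + card (C j \<inter> ?P) + 1"
      using card_Un_le[of "C j - {a j} - ?P" "C j \<inter> ?P"] by simp
    finally show ?thesis using 2 by linarith
  qed
  moreover have "?A \<union> ?P \<subseteq> V" using h_V h_sym by blast
  then have "card (V - (?A \<union> ?P)) = card V - card (?A \<union> ?P)"
      "card (?A \<union> ?P) \<le> card V"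
    using fin finite_h by (auto intro!: card_Diff_subset card_mono)
  moreover have "card ?A + card ?P = card (?A \<union> ?P) + card (?A \<inter> ?P)"
    using card_Un_Int finite_h by blast
  moreover have "card {w. g (a i) w} + 1 \<le> card ?A" "card {w. g p w} + 1 \<le> card ?P"
    using hv_deg p(2) hv_sym by blast+
  moreover have "card V \<le> card {w. g (a i) w} + card {w. g p w}"
    using p(2) by (simp add: heavy_nonadj_def)
  \<comment> \<open>Keeps the differences \<open>card (C i) - 2\<close> and
    \<open>card (C j) - 2\<close> from truncating at zero.\<close>
  moreover have "card (C i) \<ge> 2" "card (C j) \<ge> 2"
  proof -
    have "card (C m) \<ge> 2" if "index_triple m m' m''" for m m' m''
    proof -
      have "card {a m, b m} \<le> card (C m)"
        using region_finite[OF C_region[OF that]] a_in_C b_in_C by (intro card_mono) auto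
      then show ?thesis using a_neq_b_same[OF that] by simp
    qed
    then show "card (C i) \<ge> 2" "card (C j) \<ge> 2" using t t' by blast+
  qed
  ultimately show ?thesis using 1 by linarith
qed

text \<open>Otherwise there is an induced path \<open>a i\<close>, \<open>p\<close>,
  \<open>q\<close> with \<open>p\<close> interior. The tripods towards \<open>C j\<close> and
  \<open>C k\<close> cannot be resolved at \<open>p\<close>, so \<open>q\<close> becomes adjacent to
  \<open>b j\<close> and \<open>b k\<close>, which gives a claw at \<open>q\<close>.\<close>

lemma light_index_complete:
  assumes t: "index_triple i j k" and n: "\<not> heavy_index i" and w: "w \<in> C i" "w \<noteq> a i"
  shows "g (a i) w"
proof (rule ccontr)
  assume ng: "\<not> ?thesis"
  note t' = index_triple_perms[OF t]
  obtain p q where p: "interior (C i) p" "g (a i) p" and q: "interior (C i) q \<or> q = w"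
    "g p q" "\<not> g (a i) q" "q \<noteq> a i"
    using interior_two_step[OF C_region[OF t] a_in_C w ng] by blast
  have pC: "p \<in> C i" "p \<noteq> a i" using p g_irrefl unfolding interior_def by blast+
  have qC: "q \<in> C i" using q w unfolding interior_def by blast
  have nb: "\<not> bc (a i) q" using q n qC unfolding adj_or_heavy_def heavy_index_def by blast
  have adj: "h q v" if tt: "index_triple i m m'" and v: "v \<in> C m" "v \<noteq> a m" "g (a m) v" for v m m'
  proof -
    have "bc v p \<or> bc v q"
      using tripod[OF tt pC p(2) q(2) _ _ v] nb C_not_adj[OF tt qC q(4)]
        C_not_adj[OF index_triple_perms(1)[OF tt] qC q(4)] by blast
    moreover have "\<not> h p v" using p(1) C_disjoint[OF index_triple_perms(2)[OF tt] v(1)]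
      unfolding interior_def by blast
    ultimately show ?thesis using bc_imp_h h_sym by blast
  qed
  have "h q (b j)" using only_nbr[OF t'(2) C_disjoint[OF t qC]] adj[OF t] by blast
  moreover have "h q (b k)" using only_nbr[OF t'(4) C_disjoint[OF t'(1) qC]] adj[OF t'(1)] by blast
  moreover have "h q (a i)" using region_adj[OF C_region[OF t] qC a_in_C q(4)] .
  ultimately show False
    using claw_h[of q "a i" "b j" "b k"] a_neq_b[OF t] a_neq_b[OF t'(1)] b_neq[OF t'(3)]
      not_ab[OF t] not_ab[OF t'(1)] not_bb[OF t'(3)] by blast
qed

lemma outer_not_adj:
  assumes t: "index_triple i j k" and f: "f \<in> C i" "f \<noteq> a i" and w: "h f w" "w \<notin> C i"
  shows "\<not> h w (a i)" "w \<notin> K"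
proof -
  show "\<not> h w (a i)"
    using region_in[OF C_region[OF t] f(1) a_in_C f(2)] w h_sym by blast
  show "w \<notin> K"
  proof
    assume "w \<in> K"
    moreover have "w \<noteq> a i" using w a_in_C by blast
    ultimately show False using C_K_not_adj[OF t f] w by blast
  qed
qed

text \<open>A tripod along \<open>a i\<close>, \<open>f\<close>, \<open>w\<close> makes
  \<open>b k\<close>, \<open>w\<close> a \<open>bc\<close> pair. A second one, along
  \<open>a k\<close>, \<open>b k\<close>, \<open>y\<close> with pendant vertex \<open>b i\<close>,
  fails for a \<open>g\<close>-neighbour \<open>y\<close> of \<open>b k\<close> that sees neither a
  corner nor \<open>b i\<close>: \<open>w\<close> itself, or the interior common neighbour of an
  o-heavy pair \<open>b k\<close>, \<open>w\<close>.\<close>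

lemma outer_nbr_in_C_aux:
  assumes t: "index_triple i j k" and n: "\<not> heavy_index i" and f: "f \<in> C i" "f \<noteq> a i"
    and w: "g f w" "w \<notin> C i" "w \<notin> C j" "w \<notin> C k"
    and Ck: "C k = {a k, b k}" and fb: "h f (b j)"
  shows False
proof -
  note t' = index_triple_perms[OF t]
  have hw: "h f w" using g_sub w by blast
  have wK: "\<not> h w (a i)" "w \<notin> K" using outer_not_adj[OF t f hw w(2)] by blast+
  have wa: "\<not> h w (a j)" "\<not> h w (a k)" using nbr_a[OF t'(2)] nbr_a[OF t'(4)] wK w h_sym by blast+
  have fi: "f \<noteq> b i" using fb not_bb[OF t] by blast
  have gai: "g (a i) (b i)" using light_index_complete[OF t n b_in_C] a_neq_b_same[OF t] by metis
  have nfk: "\<not> h f (b k)"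
    using claw_h[of f "a i" "b j" "b k"] fb region_adj[OF C_region[OF t] f(1) a_in_C f(2)]
      a_neq_b[OF t] a_neq_b[OF t'(1)] b_neq[OF t'(3)]
      not_ab[OF t] not_ab[OF t'(1)] not_bb[OF t'(3)] by blast
  have gak: "g (a k) (b k)" using outer_nbr[OF t'(4)] Ck by blast
  have bk: "b k \<noteq> a k" "b k \<in> C k" using a_neq_b_same[OF t'(4)] b_in_C by auto
  have "bc (b k) f \<or> bc (b k) w"
    using tripod[OF t'(1) f light_index_complete[OF t n f] w(1) wa(2,1) bk(2,1) gak] wK(1) bc_imp_h h_sym
    by blast
  then have bc: "bc (b k) w" using nfk bc_imp_h h_sym by blast
  have bi: "b i \<in> C i" "b i \<noteq> a i" using b_in_C a_neq_b_same[OF t] by auto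
  have claim: False if y: "g (b k) y" "\<not> h y (a i)" "\<not> h y (a j)" "\<not> h y (a k)"
      "\<not> h y (b i)" for y
    using tripod[OF t'(4) bk(2,1) gak y(1,2,3) bi gai] y not_bb[OF t'(1)] bc_imp_h h_sym by blast
  show False
  proof (cases "g (b k) w")
    case True
    have "\<not> h w (b i)"
      using region_in[OF C_region[OF t] f(1) bi(1) fi] hw w h_sym by blast
    then show False using claim[OF True] wK wa by blast
  next
    case False
    then have hv: "hv (b k) w" using bc unfolding adj_or_heavy_def by blast
    let ?E = "span (b k) w"
    have E: "region h ?E" using region_span[OF hv_imp_h[OF hv]] .
    obtain y where y: "interior ?E y" "g (b k) y"
      using hv_interior_nbr[OF E span_self hv] by blast
    have notE: "z \<notin> ?E" if "\<not> h w z" "w \<noteq> z" for z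
      using region_adj[OF E span_self(2)] that by blast
    have "a i \<notin> ?E" "a j \<notin> ?E" "a k \<notin> ?E"
      using notE wK wa a_in_K t t' by blast+
    moreover have "b i \<notin> ?E"
      using region_adj[OF E span_self(1)] not_bb[OF t'(4)] b_neq[OF t'(4)] by blast
    ultimately show False using claim[OF y(2)] y(1) unfolding interior_def by blast
  qed
qed

text \<open>If \<open>w\<close> avoids all three regions, tripods and \<open>only_nbr\<close> shrink
  both \<open>C j\<close> and \<open>C k\<close> and make \<open>w\<close> adjacent to
  \<open>b j\<close> and \<open>b k\<close>. The claw at \<open>w\<close> then joins
  \<open>f\<close> to one of these, which is the situation of
  \<open>outer_nbr_in_C_aux\<close>.\<close>

lemma outer_nbr_in_C:
  assumes t: "index_triple i j k" and n: "\<not> heavy_index i" and f: "f \<in> C i" "f \<noteq> a i"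
    and w: "g f w" "w \<notin> C i"
  shows "w \<in> C j \<or> w \<in> C k"
proof (rule ccontr)
  assume nn: "\<not> ?thesis"
  note t' = index_triple_perms[OF t]
  have hw: "h f w" using g_sub w by blast
  have wK: "\<not> h w (a i)" "w \<notin> K" using outer_not_adj[OF t f hw w(2)] by blast+
  have wa: "\<not> h w (a j)" "\<not> h w (a k)" using nbr_a[OF t'(2)] nbr_a[OF t'(4)] wK nn h_sym by blast+
  have small: "C m = {a m, b m} \<and> h w (b m)"
    if tt: "index_triple i m m'" and m: "w \<notin> C m" "\<not> h w (a m)" "\<not> h w (a m')" for m m'
  proof (rule only_nbr[OF index_triple_perms(2)[OF tt] m(1)])
    fix v assume v: "v \<in> C m" "v \<noteq> a m" "g (a m) v"
    have "bc v f \<or> bc v w"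
      using tripod[OF tt f light_index_complete[OF t n f] w(1) m(2,3) v] wK(1) bc_imp_h h_sym by blast
    moreover have "h w v" if "h f v"
      using two_regions[OF C_region[OF t] f(1) hw that w(2)]
        C_disjoint[OF index_triple_perms(2)[OF tt] v(1)] m v by blast
    ultimately show "h w v" using bc_imp_h h_sym by blast
  qed
  have sj: "C j = {a j, b j}" "h w (b j)" using small[OF t _ wa] nn by blast+
  have sk: "C k = {a k, b k}" "h w (b k)" using small[OF t'(1) _ wa(2,1)] nn by blast+
  have "f \<noteq> b j" "f \<noteq> b k" using C_disjoint[OF t f(1)] C_disjoint[OF t'(1) f(1)] b_in_C
      by blast+
  then have "h f (b j) \<or> h f (b k)"
    using claw_h[of w f "b j" "b k"] hw sj sk h_sym b_neq[OF t'(3)] not_bb[OF t'(3)] by blast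
  then show False
    using outer_nbr_in_C_aux[OF t n f w _ _ sk(1)] outer_nbr_in_C_aux[OF t'(1) n f w _ _ sj(1)] nn by blast
qed

text \<open>Lifts the previous result from \<open>g\<close> to \<open>h\<close>. If
  \<open>f\<close>, \<open>w\<close> were not adjacent in \<open>g\<close>, their region would have
  an interior \<open>g\<close>-neighbour \<open>p\<close> of \<open>f\<close> lying in some
  \<open>C m\<close>; interiority pulls \<open>a m\<close> into that region and makes it adjacent to
  \<open>f\<close>.\<close>

lemma light_index_outer:
  assumes t: "index_triple i j k" and n: "\<not> heavy_index i" and f: "f \<in> C i" "f \<noteq> a i"
    and w: "h f w" "w \<notin> C i"
  shows "g f w" "w \<in> C j \<or> w \<in> C k"
proof -
  note t' = index_triple_perms[OF t]
  let ?D = "span f w"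
  have D: "region h ?D" using region_span w by blast
  show gw: "g f w"
  proof (rule ccontr)
    assume ng: "\<not> ?thesis"
    have "w \<noteq> f" using w f by blast
    then obtain p where p: "interior ?D p" "g f p"
      using interior_two_step[OF D span_self _ ng] by blast
    have pD: "p \<in> ?D" "p \<noteq> f" using p g_irrefl unfolding interior_def by blast+
    have "p \<notin> C i"
    proof
      assume "p \<in> C i"
      then have "C i = ?D"
        using regions_eq[OF C_region[OF t] D f(1) _ span_self(1) pD(1)] pD(2) by blast
      then show False using w span_self by blast
    qed
    then have "p \<in> C j \<or> p \<in> C k" using outer_nbr_in_C[OF t n f p(2)] by blast
    moreover have False if tt: "index_triple i m m'" and pm: "p \<in> C m" for m m'
    proof -
      have "p \<noteq> a m" using C_not_adj[OF tt f] p g_sub by blast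
      then have "h p (a m)"
        using region_adj[OF C_region[OF index_triple_perms(2)[OF tt]] pm a_in_C] by blast
      then have "a m \<in> ?D" using p unfolding interior_def by blast
      then have "h f (a m)" using region_adj[OF D span_self(1)] C_not_adj(3)[OF tt f] by blast
      then show False using C_not_adj[OF tt f] by blast
    qed
    ultimately show False using t t' by blast
  qed
  show "w \<in> C j \<or> w \<in> C k" using outer_nbr_in_C[OF t n f gw w(2)] .
qed

text \<open>Unlike in \<open>tripod\<close>, the triangle \<open>x\<close>, \<open>f\<close>,
  \<open>a i\<close> sits inside \<open>C i\<close>; it carries \<open>w\<close> at \<open>f\<close>
  and the path \<open>a k\<close>, \<open>v\<close> at \<open>a i\<close>. The pair
  \<open>f\<close>, \<open>v\<close> is absorbed by \<open>two_regions\<close>.\<close>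

lemma second_wounded:
  assumes t: "index_triple i j k" and f: "f \<in> C i" "f \<noteq> a i" "g (a i) f"
    and x: "x \<in> C i" "x \<noteq> a i" "g (a i) x" and fx: "g f x"
    and w: "w \<in> C j" "w \<noteq> a j" "g f w" and v: "v \<in> C k" "v \<noteq> a k" "g (a k) v"
  shows "h x v \<or> h w v"
proof -
  note t' = index_triple_perms[OF t]
  have wi: "w \<notin> C i" "v \<notin> C i" "w \<noteq> v"
    using C_disjoint[OF t'(2) w(1)] C_disjoint[OF t'(4) v(1)] C_disjoint[OF t'(3) w(1)] v by blast+
  have hfw: "h f w" "h f x" using g_sub w fx by blast+
  have "\<not> h x w"
    using region_in[OF C_region[OF t] x(1) f(1)] wi hfw h_sym h_irrefl by blast
  then have "\<not> bc x w" "\<not> bc x (a k)" "\<not> bc f (a k)" "\<not> bc (a i) w"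
      "\<not> bc (a i) v" "\<not> bc w (a k)"
    using C_not_adj[OF t'(1) x(1,2)] C_not_adj[OF t'(1) f(1,2)] C_not_adj[OF t'(2) w(1,2)]
      C_not_adj[OF t'(4) v(1,2)] C_not_adj[OF t'(3) w(1,2)] bc_imp_h by blast+
  then have "bc x v \<or> bc f v \<or> bc w v"
    using wounded_g[of x f "a i" w "a k" v] g_sym[OF fx] g_sym[OF f(3)] g_sym[OF x(3)] w(3)
      net_triangle[OF t'(1)] v(3) by blast
  moreover have "h w v" if "h f v"
    using two_regions[OF C_region[OF t] f(1) hfw(1) that] wi by blast
  ultimately show ?thesis using bc_imp_h by blast
qed

text \<open>An interior \<open>y\<close> cannot resolve \<open>second_wounded\<close>, so
  \<open>w\<close> must be adjacent to \<open>b k\<close>; then so is \<open>f\<close>. Repeating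
  the argument with \<open>b k\<close> for \<open>w\<close> and \<open>j\<close>, \<open>k\<close>
  exchanged makes \<open>b k\<close> adjacent to \<open>b j\<close>.\<close>

lemma light_index_no_interior_aux:
  assumes t: "index_triple i j k" and n: "\<not> heavy_index i" and y: "interior (C i) y" "g f y"
    and f: "f \<in> C i" "f \<noteq> a i" and w: "h f w" "w \<in> C j"
  shows False
proof -
  note t' = index_triple_perms[OF t]
  have gf: "g (a i) f" using light_index_complete[OF t n f] .
  have yC: "y \<in> C i" "y \<noteq> a i"
    using y a_frontier_C[OF t] unfolding interior_def by blast+
  have gy: "g (a i) y" using light_index_complete[OF t n yC] .
  have wa: "w \<noteq> a j" using C_not_adj[OF t f] w by blast
  have ny: "\<not> h y v" if "v \<notin> C i" for v using y that unfolding interior_def by blast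
  have wi: "w \<notin> C i" using C_disjoint[OF t'(2) w(2)] .
  have gw: "g f w" using light_index_outer[OF t n f w(1) wi] by blast
  have "h w v" if v: "v \<in> C k" "v \<noteq> a k" "g (a k) v" for v
    using second_wounded[OF t f gf yC gy y(2) w(2) wa gw v] ny[OF C_disjoint[OF t'(4) v(1)]] by blast
  then have wk: "h w (b k)" using only_nbr[OF t'(4) C_disjoint[OF t'(3) w(2)]] by blast
  have fj: "f \<notin> C j" "b k \<notin> C j" "f \<noteq> b k" "b k \<notin> C i"
    using C_disjoint[OF t f(1)] C_disjoint[OF t'(5) b_in_C] C_disjoint[OF t'(1) f(1)]
      C_disjoint[OF t'(4) b_in_C] b_in_C by blast+
  have "h f (b k)"
    using two_regions[OF C_region[OF t'(2)] w(2) h_sym[OF w(1)] wk] fj by blast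
  then have gk: "g f (b k)" using light_index_outer[OF t n f _ fj(4)] by blast
  have "h (b k) v" if v: "v \<in> C j" "v \<noteq> a j" "g (a j) v" for v
    using second_wounded[OF t'(1) f gf yC gy y(2) b_in_C _ gk v] a_neq_b_same[OF t'(4)]
      ny[OF C_disjoint[OF t'(2) v(1)]] by metis
  then have "h (b k) (b j)" using only_nbr[OF t'(2) fj(2)] by blast
  then show False using not_bb[OF t'(5)] by blast
qed

text \<open>2-connectedness gives a frontier vertex \<open>f\<close> besides \<open>a i\<close>. It
  and \<open>y\<close> are \<open>g\<close>-neighbours of \<open>a i\<close>, hence
  \<open>bc\<close>, so \<open>f\<close> has an interior \<open>g\<close>-neighbour in either
  case.\<close>

lemma light_index_no_interior:
  assumes t: "index_triple i j k" and n: "\<not> heavy_index i" shows "\<not> interior (C i) y"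
proof
  assume y: "interior (C i) y"
  note t' = index_triple_perms[OF t]
  have yC: "y \<in> C i" "y \<noteq> a i"
    using y a_frontier_C[OF t] unfolding interior_def by blast+
  obtain f where f: "f \<in> C i" "f \<noteq> a i" "\<not> interior (C i) f"
    using region_frontier[OF C_region[OF t] a_in_C aa[OF t] C_disjoint[OF t'(2) a_in_C]] by blast
  then obtain w where w: "h f w" "w \<notin> C i" unfolding interior_def by blast
  have "\<exists>z. interior (C i) z \<and> g f z"
  proof (cases "g f y")
    case True then show ?thesis using y by blast
  next
    case False
    have "f \<noteq> y" using f y by blast
    then have "bc f y"
      using frontier_bc_clique[OF C_region[OF t] a_in_C a_frontier_C[OF t] f(1) yC(1)]
        light_index_complete[OF t n f(1,2)] light_index_complete[OF t n yC] by blast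
    then have "hv f y" using False unfolding adj_or_heavy_def by blast
    then show ?thesis using hv_interior_nbr[OF C_region[OF t] f(1) yC(1)] by blast
  qed
  then obtain z where z: "interior (C i) z" "g f z" by blast
  have "w \<in> C j \<or> w \<in> C k" using light_index_outer[OF t n f(1,2) w] by blast
  then show False
    using light_index_no_interior_aux[OF t n z f(1,2) w(1)] light_index_no_interior_aux[OF t'(1) n z f(1,2) w(1)]
    by blast
qed

text \<open>If \<open>b i\<close> were missed, \<open>interior_two_step\<close> would provide an
  interior neighbour of \<open>a i\<close>.\<close>

lemma nbr_b_of_frontier:
  assumes t: "index_triple i j k"
    and fr: "\<And>v. v \<in> C i \<Longrightarrow> v \<noteq> a i \<Longrightarrow> g (a i) v \<Longrightarrow> \<not> interior (C i) v"
  shows "g (a i) (b i)"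
proof (rule ccontr)
  assume "\<not> ?thesis"
  then obtain p where p: "interior (C i) p" "g (a i) p"
    using interior_two_step[OF C_region[OF t] a_in_C b_in_C] a_neq_b_same[OF t] by metis
  then have "p \<in> C i" "p \<noteq> a i" using g_irrefl unfolding interior_def by blast+
  then show False using fr p by blast
qed

text \<open>Without interior vertices \<open>C i\<close> has no o-heavy pairs, so
  \<open>a i\<close>, \<open>b i\<close>, \<open>x\<close> is a triangle of \<open>g\<close>.
  Applied at \<open>b i\<close> with \<open>w\<close>, \<open>second_wounded\<close> makes
  \<open>x\<close> adjacent to \<open>b k\<close>; applied at \<open>x\<close> with
  \<open>b k\<close>, it makes \<open>b j\<close> adjacent to \<open>b i\<close> or
  \<open>b k\<close>.\<close>

lemma light_index_small_aux:
  assumes t: "index_triple i j k" and n: "\<not> heavy_index i" and x: "x \<in> C i" "x \<noteq> a i"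
      "x \<noteq> b i"
    and w: "h (b i) w" "w \<in> C j"
  shows False
proof -
  note t' = index_triple_perms[OF t]
  note nint = light_index_no_interior[OF t n]
  have bi: "b i \<in> C i" "b i \<noteq> a i" using b_in_C a_neq_b_same[OF t] by auto
  have gb: "g (a i) (b i)" using light_index_complete[OF t n bi] .
  have gx: "g (a i) x" using light_index_complete[OF t n x(1,2)] .
  have bx: "g (b i) x"
  proof (rule ccontr)
    assume nb: "\<not> ?thesis"
    have "bc (b i) x"
      using frontier_bc_clique[OF C_region[OF t] a_in_C a_frontier_C[OF t] bi(1) x(1) gb gx] x(3) by blast
    then have "hv (b i) x" using nb unfolding adj_or_heavy_def by blast
    then show False using hv_interior_nbr[OF C_region[OF t] bi(1) x(1)] nint by blast
  qed
  have wa: "w \<noteq> a j" using C_not_adj[OF t bi] w by blast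
  have wi: "w \<notin> C i" using C_disjoint[OF t'(2) w(2)] .
  have gw: "g (b i) w" using light_index_outer[OF t n bi w(1) wi] by blast
  have k1: "h x v \<or> h w v" if v: "v \<in> C k" "v \<noteq> a k" "g (a k) v" for v
    using second_wounded[OF t bi gb x(1,2) gx bx w(2) wa gw v] .
  have gk: "g (a k) (b k)"
  proof (rule nbr_b_of_frontier[OF t'(4)])
    fix v assume v: "v \<in> C k" "v \<noteq> a k" "g (a k) v"
    show "\<not> interior (C k) v"
      using k1[OF v] h_sym C_disjoint[OF t'(1) x(1)] C_disjoint[OF t'(3) w(2)]
      unfolding interior_def by blast
  qed
  have bk: "b k \<in> C k" "b k \<noteq> a k" using b_in_C a_neq_b_same[OF t'(4)] by auto
  have "\<not> h w (b k)"
  proof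
    assume "h w (b k)"
    then have "h (b i) (b k)"
      using two_regions[OF C_region[OF t'(2)] w(2) h_sym[OF w(1)]] b_neq[OF t'(1)]
        C_disjoint[OF t bi(1)] C_disjoint[OF t'(5) bk(1)] by blast
    then show False using not_bb[OF t'(1)] by blast
  qed
  then have "h x (b k)" using k1[OF bk gk] by blast
  then have gxk: "g x (b k)" using light_index_outer[OF t n x(1,2)] C_disjoint[OF t'(4) bk(1)] by blast
  have j1: "h (b i) v \<or> h (b k) v" if v: "v \<in> C j" "v \<noteq> a j" "g (a j) v" for v
    using second_wounded[OF t'(1) x(1,2) gx bi gb g_sym[OF bx] bk gxk v] .
  have gj: "g (a j) (b j)"
  proof (rule nbr_b_of_frontier[OF t'(2)])
    fix v assume v: "v \<in> C j" "v \<noteq> a j" "g (a j) v"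
    show "\<not> interior (C j) v"
      using j1[OF v] h_sym C_disjoint[OF t bi(1)] C_disjoint[OF t'(5) bk(1)]
      unfolding interior_def by blast
  qed
  show False
    using j1[OF b_in_C _ gj] a_neq_b_same[OF t'(2)] not_bb[OF t] not_bb[OF t'(5)] by metis
qed

lemma light_index_small:
  assumes t: "index_triple i j k" and n: "\<not> heavy_index i" shows "C i = {a i, b i}"
proof (rule ccontr)
  assume "\<not> ?thesis"
  then obtain x where x: "x \<in> C i" "x \<noteq> a i" "x \<noteq> b i" using a_in_C b_in_C by blast
  have bi: "b i \<in> C i" "b i \<noteq> a i" using b_in_C a_neq_b_same[OF t] by auto
  obtain w where w: "h (b i) w" "w \<notin> C i"
    using light_index_no_interior[OF t n] bi unfolding interior_def by blast
  then show False
    using light_index_outer[OF t n bi w] light_index_small_aux[OF t n x w(1)]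
      light_index_small_aux[OF index_triple_perms(1)[OF t] n x w(1)] by blast
qed

section \<open>The exceptional region and q-heaviness\<close>

text \<open>The light region \<open>C j\<close> has only two vertices and offers \<open>b i\<close>
  no neighbour, so its outside neighbours are in \<open>C k\<close>; two of them would put
  \<open>b i\<close> into \<open>C k\<close>.\<close>

lemma light_index_link:
  assumes t: "index_triple i j k" and n: "\<not> heavy_index i" "\<not> heavy_index j"
  obtains u where "u \<in> C k" "u \<noteq> a k" "g (b i) u" "{w. h (b i) w} = {a i, u}"
proof -
  note t' = index_triple_perms[OF t]
  have Ci: "C i = {a i, b i}" and Cj: "C j = {a j, b j}"
    using light_index_small[OF t n(1)] light_index_small[OF t'(2) n(2)] .
  have bi: "b i \<in> C i" "b i \<noteq> a i" using b_in_C a_neq_b_same[OF t] by auto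
  have out: "g (b i) w \<and> w \<in> C k \<and> w \<noteq> a k" if w: "h (b i) w" "w \<notin> C i" for w
  proof -
    have "w \<notin> C j" using w(1) Cj not_ab[OF t'(2)] not_bb[OF t] h_sym[OF w(1)] by auto
    moreover have "w \<noteq> a k" using not_ab[OF t'(4)] h_sym[OF w(1)] by auto
    ultimately show ?thesis using light_index_outer[OF t n(1) bi w] by blast
  qed
  obtain u where u: "h (b i) u" "u \<notin> C i"
    using light_index_no_interior[OF t n(1)] bi unfolding interior_def by blast
  have "w = u" if "h (b i) w" "w \<notin> C i" for w
    using region_in[OF C_region[OF t'(4)], of w u "b i"] out[OF that] out[OF u] that u
      C_disjoint[OF t'(1) bi(1)] by blast
  moreover have "h (b i) (a i)" using h_sym ab[OF t] by blast
  moreover have "\<not> h (b i) (b i)" using h_irrefl .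
  ultimately have "{w. h (b i) w} = {a i, u}" using Ci u by blast
  then show ?thesis using that out[OF u] by blast
qed

text \<open>Once \<open>K\<close> is the bare triangle, at most two \<open>g\<close>-neighbours of
  \<open>a k\<close> lie outside \<open>C k\<close>; nonneighbours inside \<open>C k\<close> offset
  them in the count.\<close>

lemma net_q_heavy_aux:
  assumes t: "index_triple i j k" and n: "\<not> heavy_index i" "\<not> heavy_index j"
    and u: "u \<in> C k" "u \<noteq> a k" "g (b i) u" "{w. h (b i) w} = {a i, u}"
    and v: "v \<in> C k" "v \<noteq> a k" "g (b j) v" "{w. h (b j) w} = {a j, v}"
  shows "K = {a i, a j, a k}" "card V \<le> 2 * (card (C k) - 1)"
proof -
  note t' = index_triple_perms[OF t]
  have bi: "b i \<in> C i" "b i \<noteq> a i" using b_in_C a_neq_b_same[OF t] by auto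
  have bj: "b j \<in> C j" "b j \<noteq> a j" using b_in_C a_neq_b_same[OF t'(2)] by auto
  have gb: "g (a i) (b i)" "g (a j) (b j)"
    using light_index_complete[OF t n(1) bi] light_index_complete[OF t'(2) n(2) bj] .
  have hu: "h u (b i)" "h v (b j)" using u v g_sub h_sym by blast+
  have hka: "h u (a k)" "h v (a k)" using region_adj[OF C_region[OF t'(4)] _ a_in_C] u v by blast+
  have uv: "u \<noteq> v"
  proof
    assume "u = v"
    then show False
      using claw_h[of u "a k" "b i" "b j"] hu hka a_neq_b[OF t'(4)] a_neq_b[OF t'(5)] b_neq[OF t]
        not_ab[OF t'(4)] not_ab[OF t'(5)] not_bb[OF t] by blast
  qed
  have una: "\<not> h u (a i)" "\<not> h u (a j)" "u \<noteq> a i" "u \<noteq> a j" "\<not> h v (a i)"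
      "\<not> h v (a j)" "v \<noteq> a i" "v \<noteq> a j"
    using C_not_adj[OF t'(4) u(1,2)] C_not_adj[OF t'(5) u(1,2)] C_not_adj[OF t'(4) v(1,2)]
      C_not_adj[OF t'(5) v(1,2)] by blast+
  have nuv: "\<not> h (b i) v" "\<not> h (b j) u" using u(4) v(4) uv una by blast+
  have bC: "b i \<notin> C k" "b j \<notin> C k" using C_disjoint[OF t'(1) bi(1)] C_disjoint[OF t'(3) bj(1)] .
  show K3: "K = {a i, a j, a k}"
  proof (rule ccontr)
    assume "\<not> ?thesis"
    then obtain s where s: "s \<in> K" "s \<noteq> a i" "s \<noteq> a j" "s \<noteq> a k"
      using a_in_K[OF t] a_in_K[OF t'(2)] a_in_K[OF t'(4)] by blast
    \<comment> \<open>Wounded graph with triangle \<open>z\<close>, \<open>a i\<close>,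
      \<open>a j\<close>, pendant vertex \<open>b i\<close>, and path \<open>b j\<close>,
      \<open>v\<close> at \<open>a j\<close>.\<close>
    have twin: False if z: "z \<in> K" "z \<noteq> a i" "z \<noteq> a j" "z \<noteq> a k" "g (a i) z"
        "g (a j) z" for z
    proof -
      have "\<not> bc z (b i)" "\<not> bc z (b j)" "\<not> bc z v" "\<not> bc (a i) (b j)"
          "\<not> bc (a i) v" "\<not> bc (a j) (b i)"
        "\<not> bc (a j) v" "\<not> bc (b i) (b j)" "\<not> bc (b i) v"
        using C_K_not_adj[OF t bi z(1,2)] C_K_not_adj[OF t'(2) bj z(1,3)] C_K_not_adj[OF t'(4) v(1,2) z(1,4)]
          not_ab[OF t] una not_ab[OF t'(2)] not_bb[OF t] nuv bc_imp_h h_sym by blast+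
      then show False
        using wounded_g[of z "a i" "a j" "b i" "b j" v] z(5,6) net_triangle[OF t] gb v(3) g_sym by blast
    qed
    \<comment> \<open>A missed vertex gives an interior \<open>g\<close>-neighbour \<open>p\<close>
      of \<open>a m\<close>; it is \<open>bc\<close> to \<open>a m'\<close>, hence adjacent since
      both are in \<open>M\<close>, and \<open>twin\<close> applies.\<close>
    have full: "g (a m) z" if tt: "index_triple m m' k" "{m, m'} = {i, j}" and z: "z \<in> K"
        "z \<noteq> a m" for m m' z
    proof (rule ccontr)
      assume "\<not> ?thesis"
      then obtain p where p: "interior K p" "g (a m) p"
        using interior_two_step[OF K_region a_in_K[OF tt(1)] z] by blast
      have pm: "p \<in> K" "p \<noteq> a m" "p \<noteq> a m'" "p \<noteq> a k"
        using p a_frontier_K[OF tt(1)] a_frontier_K[OF index_triple_perms(2)[OF tt(1)]]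
          a_frontier_K[OF index_triple_perms(4)[OF tt(1)]] unfolding interior_def by blast+
      have "bc p (a m')"
        using frontier_bc_clique[OF K_region a_in_K[OF tt(1)] a_frontier_K[OF tt(1)] pm(1)
          a_in_K[OF index_triple_perms(2)[OF tt(1)]] p(2) net_triangle[OF tt(1)] pm(3)] .
      then have "g p (a m')"
        using M_bc[OF interior_in_M[OF p(1)] a_in_M[OF index_triple_perms(2)[OF tt(1)]]] by blast
      then have "g (a m') p" using g_sym by blast
      moreover have "m = i \<and> m' = j \<or> m = j \<and> m' = i" using tt(2)
          by (auto simp: doubleton_eq_iff)
      ultimately show False using twin[of p] pm p(2) by blast
    qed
    have "g (a i) s" "g (a j) s"
      using full[OF t _ s(1,2)] full[OF t'(2) _ s(1,3)] by auto
    then show False using twin[OF s] by blast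
  qed
  have hk: "heavy_index k"
  proof (rule ccontr)
    assume "\<not> ?thesis"
    then have "u = b k" using light_index_small[OF t'(4)] u by blast
    then show False using hu(1) not_bb[OF t'(4)] by blast
  qed
  have Ck: "region h (C k)" "finite (C k)" using C_region[OF t'(4)] region_finite by blast+
  have ca: "a k \<in> C k" using a_in_C .
  have deg_a: "card {w. g (a k) w} + card X \<le> card (C k) + 1"
    if X: "X \<subseteq> C k - {a k}" "\<And>x. x \<in> X \<Longrightarrow> \<not> g (a k) x" for X
  proof -
    have "{w. g (a k) w} \<subseteq> {a i, a j} \<union> (C k - {a k} - X)"
      using nbr_a[OF t'(4)] g_sub X K3 g_irrefl by blast
    then have "card {w. g (a k) w} \<le> card ({a i, a j} \<union> (C k - {a k} - X))"
      using Ck by (intro card_mono) auto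
    also have "\<dots> \<le> card {a i, a j} + card (C k - {a k} - X)" by (rule card_Un_le)
    also have "card (C k - {a k} - X) = card (C k - {a k}) - card X"
      using X(1) Ck finite_subset by (intro card_Diff_subset) auto
    finally have "card {w. g (a k) w} \<le> 2 + (card (C k) - 1 - card X)"
      using a_neq[OF t] Ck ca by simp
    moreover have "card X \<le> card (C k) - 1"
      using card_mono[of "C k - {a k}" X] X(1) Ck ca by simp
    moreover have "card (C k) \<ge> 1" using ca Ck by (metis One_nat_def Suc_leI card_gt_0_iff empty_iff)
    ultimately show ?thesis by linarith
  qed
  have hvV: "card V \<le> card {w. g (a k) w} + card {w. g x w}" if "hv (a k) x" for x
    using that by (simp add: heavy_nonadj_def)
  \<comment> \<open>Write \<open>c\<close> for \<open>card (C k)\<close>. An interior partner of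
    \<open>a k\<close> has degree at most \<open>c - 2\<close> and \<open>a k\<close> at most
    \<open>c\<close>. Otherwise \<open>u\<close> is a partner, of degree at most
    \<open>c - 1\<close> because of \<open>b i\<close>, and \<open>a k\<close> misses both
    \<open>u\<close> and \<open>v\<close>, leaving \<open>c - 1\<close>.\<close>
  show "card V \<le> 2 * (card (C k) - 1)"
  proof (cases "\<exists>p. interior (C k) p \<and> hv (a k) p")
    case True
    then obtain p where p: "interior (C k) p" "hv (a k) p" by blast
    have pC: "p \<in> C k" "p \<noteq> a k" "\<not> g (a k) p" "\<not> g p (a k)"
      using p g_sym unfolding interior_def heavy_nonadj_def by blast+
    have "{w. g p w} \<subseteq> C k - {p, a k}"
      using p(1) pC g_sub g_irrefl unfolding interior_def by blast
    then have "card {w. g p w} \<le> card (C k) - 2"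
      using card_mono[of "C k - {p, a k}" "{w. g p w}"] Ck ca pC by (simp add: card_Diff_subset)
    moreover have "card {p, a k} \<le> card (C k)" using Ck ca pC by (intro card_mono) auto
    moreover have "card {w. g (a k) w} + card {p} \<le> card (C k) + 1" using deg_a[of "{p}"] pC by blast
    ultimately show ?thesis using hvV[OF p(2)] pC by simp
  next
    case False
    have full: "g (a k) y" if y: "interior (C k) y" for y
    proof (rule ccontr)
      assume ng: "\<not> ?thesis"
      have yC: "y \<in> C k" "y \<noteq> a k" using y a_frontier_C[OF t'(4)] unfolding interior_def by blast+
      obtain p q where p: "interior (C k) p" "g (a k) p" and q: "interior (C k) q" "g p q"
          "\<not> g (a k) q" "q \<noteq> a k"
        using interior_two_step[OF Ck(1) ca yC ng] y by blast
      have pC: "p \<in> C k" "p \<noteq> a k" "q \<in> C k" using p q g_irrefl unfolding interior_def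
          by blast+
      have "bc (a k) q"
        using tripod[OF t'(4) pC(1,2) p(2) q(2) _ _ bi gb(1)] C_not_adj[OF t'(4) pC(3) q(4)]
          C_not_adj[OF t'(5) pC(3) q(4)] p(1) q(1) bC bc_imp_h h_sym unfolding interior_def by blast
      then show False using q False unfolding adj_or_heavy_def by blast
    qed
    obtain p0 where "p0 \<in> C k" "hv (a k) p0" using hk unfolding heavy_index_def by blast
    then obtain y where y: "interior (C k) y" using hv_interior_nbr[OF Ck(1) ca] by blast
    \<comment> \<open>Adjacency would give a triangle \<open>a k\<close>, \<open>x\<close>,
      \<open>z\<close> of \<open>g\<close> with \<open>z\<close> interior. In
      \<open>second_wounded\<close> neither \<open>z\<close> nor \<open>b m\<close> can be adjacent
      to \<open>b m'\<close>.\<close>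
    have notadj: "\<not> g (a k) x"
      if tt: "index_triple k m m'" and x: "x \<in> C k" "x \<noteq> a k" "g x (b m)"
          "\<not> interior (C k) x" and gm: "g (a m') (b m')" for m m' x
    proof
      assume gx: "g (a k) x"
      note tt' = index_triple_perms[OF tt]
      have "\<exists>z. interior (C k) z \<and> g x z"
      proof (cases "g x y")
        case True then show ?thesis using y by blast
      next
        case False
        have "x \<noteq> y" "y \<in> C k" using x y unfolding interior_def by blast+
        then have "bc x y"
          using frontier_bc_clique[OF Ck(1) ca a_frontier_C[OF t'(4)] x(1) _ gx full[OF y]] by blast
        then have "hv x y" using False unfolding adj_or_heavy_def by blast
        then show ?thesis using hv_interior_nbr[OF Ck(1) x(1) \<open>y \<in> C k\<close>] by blast
      qed
      then obtain z where z: "interior (C k) z" "g x z" by blast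
      have zC: "z \<in> C k" "z \<noteq> a k" using z a_frontier_C[OF t'(4)] unfolding interior_def by blast+
      have "h z (b m') \<or> h (b m) (b m')"
        using second_wounded[OF tt x(1,2) gx zC full[OF z(1)] z(2) b_in_C _ x(3) b_in_C _ gm]
          a_neq_b_same[OF tt'(2)] a_neq_b_same[OF tt'(4)] by metis
      then show False
        using not_bb[OF tt'(3)] z(1) C_disjoint[OF tt'(4) b_in_C] unfolding interior_def by blast
    qed
    have fr: "\<not> interior (C k) u" "\<not> interior (C k) v" using hu bC unfolding interior_def by blast+
    have nu: "\<not> g (a k) u" "\<not> g (a k) v"
      using notadj[OF t'(4) u(1,2) g_sym[OF u(3)] fr(1) gb(2)]
        notadj[OF t'(5) v(1,2) g_sym[OF v(3)] fr(2) gb(1)] .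
    obtain p where p: "interior (C k) p" "g (a k) p" "g p u"
      using interior_two_step[OF Ck(1) ca u(1,2) nu(1)] full by blast
    have pC: "p \<in> C k" "p \<noteq> a k" using p g_irrefl unfolding interior_def by blast+
    have "bc (a k) u"
      using tripod[OF t'(5) pC p(2,3) una(2,1) bj gb(2)] p(1) bC nuv bc_imp_h h_sym
      unfolding interior_def by blast
    then have hvu: "hv (a k) u" using nu unfolding adj_or_heavy_def by blast
    \<comment> \<open>A neighbour of \<open>u\<close> outside \<open>C k\<close> other than
      \<open>b i\<close> would be adjacent to \<open>b i\<close>, whose only neighbours are
      \<open>a i\<close> and \<open>u\<close>.\<close>
    have "{w. g u w} \<subseteq> (C k - {u, a k}) \<union> {b i}"
    proof
      fix w assume w: "w \<in> {w. g u w}"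
      show "w \<in> (C k - {u, a k}) \<union> {b i}"
      proof (cases "w \<in> C k")
        case True
        then show ?thesis using w nu g_sym g_irrefl by blast
      next
        case False
        have "h u w" using w g_sub by blast
        then have "w = b i \<or> h (b i) w"
          using two_regions[OF Ck(1) u(1) hu(1) _ bC(1) False] by blast
        moreover have "w \<noteq> a i" "w \<noteq> u" using \<open>h u w\<close> una h_irrefl by blast+
        ultimately show ?thesis using u(4) by blast
      qed
    qed
    then have "card {w. g u w} \<le> card ((C k - {u, a k}) \<union> {b i})"
      using Ck by (intro card_mono) auto
    also have "\<dots> \<le> card (C k - {u, a k}) + card {b i}" by (rule card_Un_le)
    finally have "card {w. g u w} \<le> card (C k) - 2 + 1"
      using Ck ca u by (simp add: card_Diff_subset)
    moreover have "card {u, a k} \<le> card (C k)" using Ck ca u by (intro card_mono) auto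
    then have "card (C k) \<ge> 2" using u by simp
    moreover have "card {w. g (a k) w} + card {u, v} \<le> card (C k) + 1"
      using deg_a[of "{u, v}"] u v nu by blast
    ultimately show ?thesis using hvV[OF hvu] uv by simp
  qed
qed

text \<open>\<open>heavy_index_card\<close> cannot hold in both directions, so two indices are
  light. Every vertex of the clique \<open>C k\<close> sees the rest of it, at least half of
  \<open>V\<close>; this covers \<open>a k\<close>, \<open>b k\<close> and the second neighbours of
  \<open>b i\<close> and \<open>b j\<close>.\<close>

lemma net_q_heavy:
  "\<exists>i j k. index_triple i j k \<and>
    card V \<le> 2 * card {w. h (a k) w} \<and> card V \<le> 2 * card {w. h (b k) w} \<and>
    (\<forall>m\<in>{i, j}. card {w. h (a m) w} = 3 \<and> card {w. h (b m) w} = 2 \<and>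
      (\<forall>x. h (b m) x \<longrightarrow> x \<noteq> a m \<longrightarrow> card V \<le> 2 * card {w. h x w}))"
proof -
  have one: "\<not> heavy_index i \<or> \<not> heavy_index j" if t: "index_triple i j k" for i j k
    using heavy_index_card[OF t] heavy_index_card[OF index_triple_perms(2)[OF t]] by force
  obtain i j k where t: "index_triple i j k" and n: "\<not> heavy_index i" "\<not> heavy_index j"
    using one triple_123 index_triple_perms[OF triple_123] by metis
  note t' = index_triple_perms[OF t]
  obtain u where u: "u \<in> C k" "u \<noteq> a k" "g (b i) u" "{w. h (b i) w} = {a i, u}"
    using light_index_link[OF t n] .
  obtain v where v: "v \<in> C k" "v \<noteq> a k" "g (b j) v" "{w. h (b j) w} = {a j, v}"
    using light_index_link[OF t'(2) n(2,1)] .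
  note q = net_q_heavy_aux[OF t n u v]
  have heavy: "card V \<le> 2 * card {w. h x w}" if x: "x \<in> C k" for x
  proof -
    have "card (C k - {x}) \<le> card {w. h x w}"
      using region_adj[OF C_region[OF t'(4)] x] finite_h by (intro card_mono) auto
    then show ?thesis using q(2) x region_finite[OF C_region[OF t'(4)]] by simp
  qed
  have deg: "card {w. h (a m) w} = 3"
    if tt: "index_triple m m' k" and K: "K = {a m, a m', a k}" and n: "\<not> heavy_index m" for m m'
  proof -
    note tt' = index_triple_perms[OF tt]
    have "w \<in> {a m', a k, b m}" if "h (a m) w" for w
      using nbr_a[OF tt that] that light_index_small[OF tt n] K h_irrefl[of "a m"] by auto
    then have "{w. h (a m) w} = {a m', a k, b m}"
      using aa[OF tt] aa[OF tt'(1)] ab[OF tt] by blast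
    then show ?thesis
      using a_neq[OF tt'(3)] a_neq_b[OF tt'(2)] a_neq_b[OF tt'(4)] by simp
  qed
  have "card {w. h (a i) w} = 3" "card {w. h (a j) w} = 3"
    using deg[OF t q(1) n(1)] deg[OF t'(2) _ n(2)] q(1) by (auto simp: insert_commute)
  moreover have "card {w. h (b i) w} = 2" "card {w. h (b j) w} = 2"
    unfolding u(4) v(4) using C_not_adj(3)[OF t'(4) u(1,2)] C_not_adj(3)[OF t'(5) v(1,2)] by auto
  moreover have "card V \<le> 2 * card {w. h x w}" if "h (b i) x" "x \<noteq> a i" for x
    using that u(4) heavy[OF u(1)] by blast
  moreover have "card V \<le> 2 * card {w. h x w}" if "h (b j) x" "x \<noteq> a j" for x
    using that v(4) heavy[OF v(1)] by blast
  ultimately have "\<forall>m\<in>{i, j}. card {w. h (a m) w} = 3 \<and> card {w. h (b m) w} = 2 \<and>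
      (\<forall>x. h (b m) x \<longrightarrow> x \<noteq> a m \<longrightarrow> card V \<le> 2 * card {w. h x w})"
    by blast
  then show ?thesis
    using t heavy[OF a_in_C] heavy[OF b_in_C] by metis
qed

end

section \<open>The c-closure\<close>

abbreviation adj :: "'a pair_pre_digraph \<Rightarrow> 'a \<Rightarrow> 'a \<Rightarrow> bool" where
  "adj G u v \<equiv> (u, v) \<in> parcs G"

abbreviation bc_adj :: "'a pair_pre_digraph \<Rightarrow> 'a \<Rightarrow> 'a \<Rightarrow> bool" where
  "bc_adj G \<equiv> adj_or_heavy (pverts G) (adj G)"

lemma heavy_nonadj_adj: "heavy_nonadj (pverts G) (adj G) = o_heavy_pair G"
  by (intro ext) (simp add: heavy_nonadj_def o_heavy_pair_def degree_def nbhd_def)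

lemma bc_adj_iff: "bc_adj G u v \<longleftrightarrow> adj G u v \<or> o_heavy_pair G u v"
  by (simp add: adj_or_heavy_def heavy_nonadj_adj)

text \<open>Claw-o-heaviness without isomorphisms: the centre is adjacent to every leaf, so only two
  leaves can form an o-heavy pair.\<close>

definition claw_heavy :: "'a pair_pre_digraph \<Rightarrow> bool" where
  "claw_heavy G \<longleftrightarrow> (\<forall>x p q r. adj G x p \<longrightarrow> adj G x q \<longrightarrow> adj G x r \<longrightarrow>
     p \<noteq> q \<longrightarrow> p \<noteq> r \<longrightarrow> q \<noteq> r \<longrightarrow> bc_adj G p q \<or> bc_adj G p r \<or> bc_adj G q r)"

lemma pair_graphD:
  assumes "pair_graph G"
  shows "adj G u v \<Longrightarrow> adj G v u" "\<not> adj G u u"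
      "adj G u v \<Longrightarrow> u \<in> pverts G"
    "adj G u v \<Longrightarrow> v \<in> pverts G" "finite (pverts G)" "finite (nbhd G u)"
proof -
  interpret pair_graph G by fact
  show "adj G u v \<Longrightarrow> adj G v u" by (rule arcs_symmetric)
  show "\<not> adj G u u" using no_loops' by blast
  show "adj G u v \<Longrightarrow> u \<in> pverts G" "adj G u v \<Longrightarrow> v \<in> pverts G"
    using in_arcsD1 in_arcsD2 by blast+
  show "finite (pverts G)" by (rule pair_finite_verts)
  then show "finite (nbhd G u)"
    using in_arcsD2 by (auto simp: nbhd_def intro: finite_subset[of _ "pverts G"])
qed

lemma connected_induce_cut:
  assumes c: "connected (with_proj B \<restriction> S)" and sym:
      "\<And>u v. adj B u v \<Longrightarrow> adj B v u"
    and A: "A \<subseteq> S" "A \<noteq> {}" "A \<noteq> S"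
  shows "\<exists>x\<in>A. \<exists>y\<in>S - A. adj B x y"
proof (rule ccontr)
  assume no: "\<not> ?thesis"
  obtain u v where uv: "u \<in> A" "v \<in> S" "v \<notin> A" using A by blast
  let ?R = "(arcs_ends (with_proj B \<restriction> S))\<^sup>s"
  have R: "adj B x y" if "(x, y) \<in> ?R" for x y
    using that sym by (auto simp: symcl_def arcs_ends_conv)
  have "(u, v) \<in> rtrancl_on S ?R"
    using c uv A unfolding connected_conv by auto
  then have "v \<in> A"
  proof (induction rule: rtrancl_on_induct)
    case base then show ?case using uv by simp
  next
    case (step y z) then show ?case using R no by blast
  qed
  then show False using uv by blast
qed

lemma not_connected_induce_cut:
  assumes c: "\<not> connected (with_proj B \<restriction> S)" and S: "S \<noteq> {}"
  shows "\<exists>A. A \<subseteq> S \<and> A \<noteq> {} \<and> A \<noteq> S \<and> (\<forall>x\<in>A. \<forall>y\<in>S - A. \<not> adj B x y)"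
proof -
  let ?R = "(arcs_ends (with_proj B \<restriction> S))\<^sup>s"
  obtain u v where uv: "u \<in> S" "v \<in> S" "(u, v) \<notin> rtrancl_on S ?R"
    using c S unfolding connected_conv by auto
  let ?A = "{w \<in> S. (u, w) \<in> rtrancl_on S ?R}"
  have "\<not> adj B x y" if "x \<in> ?A" "y \<in> S - ?A" for x y
  proof
    assume "adj B x y"
    then have "(x, y) \<in> ?R" using that by (force simp: symcl_def arcs_ends_conv)
    then show False using that rtrancl_on_into_rtrancl_on[of u x S ?R y] by blast
  qed
  moreover have "u \<in> ?A" "v \<notin> ?A" using uv by auto
  ultimately show ?thesis using uv by (intro exI[of _ ?A]) blast
qed

section \<open>Claws, wounded graphs and local completion\<close>

lemma pair_wf_claw: "pair_wf_digraph claw" and pair_wf_wounded: "pair_wf_digraph wounded"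
  by (unfold_locales, auto simp: claw_def wounded_def from_edges_def)+

lemma claw_heavyI:
  assumes G: "pair_graph G" and "H_o_heavy claw G" shows "claw_heavy G"
  unfolding claw_heavy_def
proof (intro allI impI, rule ccontr)
  fix x p q r
  assume e: "adj G x p" "adj G x q" "adj G x r" and d: "p \<noteq> q" "p \<noteq> r" "q \<noteq> r"
    and n: "\<not> (bc_adj G p q \<or> bc_adj G p r \<or> bc_adj G q r)"
  note D = pair_graphD[OF G]
  have n': "\<not> adj G p q" "\<not> adj G p r" "\<not> adj G q r" "\<not> adj G q p" "\<not> adj G r p"
      "\<not> adj G r q"
    using n D(1) unfolding bc_adj_iff by blast+
  have e': "adj G p x" "adj G q x" "adj G r x" using e D(1) by blast+
  have dx: "x \<noteq> p" "x \<noteq> q" "x \<noteq> r" using e D(2) by blast+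
  \<comment> \<open>The default value \<open>x\<close> is the image of \<open>0\<close>, the
    centre.\<close>
  let ?f = "(\<lambda>_. x)(1 := p, 2 := q, 3 := r) :: nat \<Rightarrow> 'a"
  have emb: "induced_embedding ?f claw G"
    unfolding induced_embedding_def
    using e e' n' d dx D(2) D(3)[OF e(1)] D(4)[OF e(1)] D(4)[OF e(2)] D(4)[OF e(3)]
    by (auto simp: claw_def from_edges_def inj_on_def)
  have im: "?f ` pverts claw = {x, p, q, r}" by (auto simp: claw_def from_edges_def)
  have S: "{x, p, q, r} \<subseteq> pverts G" using e D(3,4) by blast
  have iso: "digraph_iso (with_proj claw) (with_proj G \<restriction> {x, p, q, r})"
    using digraph_iso_induce_iff[OF pair_wf_claw S] emb im by blast
  obtain u v where uv: "u \<in> {x, p, q, r}" "v \<in> {x, p, q, r}" "o_heavy_pair G u v"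
    using assms(2)[unfolded H_o_heavy_def, rule_format, OF S iso] by (elim bexE)
  have edge: "\<not> o_heavy_pair G s t" if "s = t \<or> adj G s t" for s t
    using that by (auto simp: o_heavy_pair_def)
  have non: "\<not> o_heavy_pair G p q" "\<not> o_heavy_pair G p r" "\<not> o_heavy_pair G q r"
    using n unfolding bc_adj_iff by blast+
  have sym: "\<not> o_heavy_pair G t s" if "\<not> o_heavy_pair G s t" for s t
    using that D(1) by (auto simp: o_heavy_pair_def)
  have "\<forall>u\<in>{x, p, q, r}. \<forall>v\<in>{x, p, q, r}. \<not> o_heavy_pair G u v"
    using non non[THEN sym] by (simp add: edge e e')
  then show False using uv by blast
qed

lemma wounded_heavyI:
  assumes G: "pair_graph G" and "H_o_heavy wounded G"
    and e: "adj G x y" "adj G y z" "adj G x z" "adj G y p" "adj G z q" "adj G q r"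
  shows "bc_adj G x p \<or> bc_adj G x q \<or> bc_adj G x r \<or> bc_adj G y q \<or> bc_adj G y r \<or> bc_adj G z p \<or>
    bc_adj G z r \<or> bc_adj G p q \<or> bc_adj G p r"
proof (rule ccontr)
  assume n: "\<not> ?thesis"
  note D = pair_graphD[OF G]
  have n': "\<not> adj G x p" "\<not> adj G x q" "\<not> adj G x r" "\<not> adj G y q" "\<not> adj G y r"
      "\<not> adj G z p"
    "\<not> adj G z r" "\<not> adj G p q" "\<not> adj G p r"
    using n unfolding bc_adj_iff by blast+
  have n'': "\<not> adj G p x" "\<not> adj G q x" "\<not> adj G r x" "\<not> adj G q y"
      "\<not> adj G r y" "\<not> adj G p z"
    "\<not> adj G r z" "\<not> adj G q p" "\<not> adj G r p"
    using n' D(1) by blast+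
  have e': "adj G y x" "adj G z y" "adj G z x" "adj G p y" "adj G q z" "adj G r q"
    using e D(1) by blast+
  have d: "x \<noteq> y" "x \<noteq> z" "x \<noteq> p" "x \<noteq> q" "x \<noteq> r" "y \<noteq> z"
      "y \<noteq> p" "y \<noteq> q" "y \<noteq> r" "z \<noteq> p" "z \<noteq> q" "z \<noteq> r"
    "p \<noteq> q" "p \<noteq> r" "q \<noteq> r"
    using e e' n' n'' D(2) by blast+
  \<comment> \<open>Again the default value is the image of \<open>0\<close>.\<close>
  let ?f = "(\<lambda>_. x)(1 := y, 2 := z, 3 := p, 4 := q, 5 := r) :: nat \<Rightarrow> 'a"
  have V: "x \<in> pverts G" "y \<in> pverts G" "z \<in> pverts G" "p \<in> pverts G" "q \<in> pverts G"
      "r \<in> pverts G"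
    using e e' D(3) by blast+
  have emb: "induced_embedding ?f wounded G"
    unfolding induced_embedding_def
    using e e' n' n'' d D(2) V
    by (auto simp: wounded_def from_edges_def inj_on_def)
  have im: "?f ` pverts wounded = {x, y, z, p, q, r}" by (auto simp: wounded_def from_edges_def)
  have S: "{x, y, z, p, q, r} \<subseteq> pverts G" using V by blast
  have iso: "digraph_iso (with_proj wounded) (with_proj G \<restriction> {x, y, z, p, q, r})"
    using digraph_iso_induce_iff[OF pair_wf_wounded S] emb im by blast
  obtain u v where uv: "u \<in> {x, y, z, p, q, r}" "v \<in> {x, y, z, p, q, r}" "o_heavy_pair G u v"
    using assms(2)[unfolded H_o_heavy_def, rule_format, OF S iso] by (elim bexE)
  have edge: "\<not> o_heavy_pair G s t" if "s = t \<or> adj G s t" for s t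
    using that by (auto simp: o_heavy_pair_def)
  have non: "\<not> o_heavy_pair G x p" "\<not> o_heavy_pair G x q" "\<not> o_heavy_pair G x r"
      "\<not> o_heavy_pair G y q"
    "\<not> o_heavy_pair G y r" "\<not> o_heavy_pair G z p" "\<not> o_heavy_pair G z r"
        "\<not> o_heavy_pair G p q"
    "\<not> o_heavy_pair G p r"
    using n unfolding bc_adj_iff by blast+
  have sym: "\<not> o_heavy_pair G t s" if "\<not> o_heavy_pair G s t" for s t
    using that D(1) by (auto simp: o_heavy_pair_def)
  have "\<forall>u\<in>{x, y, z, p, q, r}. \<forall>v\<in>{x, y, z, p, q, r}. \<not> o_heavy_pair G u v"
    using non non[THEN sym] by (simp add: edge e e')
  then show False using uv by blast
qed

lemma local_completion_simps:
  "pverts (local_completion G x) = pverts G"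
  "adj (local_completion G x) u v \<longleftrightarrow> adj G u v \<or> adj G x u \<and> adj G x v \<and> u \<noteq> v"
  by (auto simp: local_completion_def nbhd_def)

text \<open>Degrees only grow, so an o-heavy pair either becomes an edge or stays o-heavy.\<close>

lemma bc_adj_local_completion:
  assumes G: "pair_graph G" and "bc_adj G u v" shows "bc_adj (local_completion G x) u v"
proof -
  let ?G = "local_completion G x"
  have deg: "degree G w \<le> degree ?G w" for w
    unfolding degree_def using pair_graphD(6)[OF pair_graph_local_completion[OF G]]
    by (intro card_mono) (auto simp: nbhd_def local_completion_simps)
  show ?thesis
    using assms(2) deg[of u] deg[of v] unfolding bc_adj_iff unfolding o_heavy_pair_def local_completion_simps
    by auto
qed

text \<open>If a claw at \<open>w\<close> uses a new edge to \<open>a\<close>, then \<open>b\<close>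
  and \<open>c\<close> are not neighbours of \<open>x\<close>, so their edges to \<open>w\<close>
  are old and \<open>x\<close> can replace \<open>a\<close> in a claw of \<open>G\<close>.\<close>

lemma claw_heavy_local_completion:
  assumes G: "pair_graph G" and cl: "claw_heavy G" shows "claw_heavy (local_completion G x)"
proof -
  let ?G = "local_completion G x"
  note D = pair_graphD[OF G]
  have G': "pair_graph ?G" using pair_graph_local_completion[OF G] .
  note D' = pair_graphD[OF G']
  have sym: "bc_adj ?G v u" if "bc_adj ?G u v" for u v
    using that D'(1) by (auto simp: bc_adj_iff o_heavy_pair_def)
  have new: False
    if w: "adj G x w" "adj G x a" and e: "adj ?G w b" "adj ?G w c" "b \<noteq> c"
      and d: "a \<noteq> b" "a \<noteq> c" and n: "\<not> bc_adj ?G a b" "\<not> bc_adj ?G a c"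
          "\<not> bc_adj ?G b c" for w a b c
  proof -
    have na: "\<not> adj ?G a b" "\<not> adj ?G a c" using n unfolding bc_adj_iff by blast+
    have nx: "\<not> adj G x b" "\<not> adj G x c" "x \<noteq> b" "x \<noteq> c"
      using na w d D(1) unfolding local_completion_simps by blast+
    have "adj G w x" "adj G w b" "adj G w c"
      using e nx w D(1) unfolding local_completion_simps by blast+
    then have "bc_adj G x b \<or> bc_adj G x c \<or> bc_adj G b c"
      using cl nx e(3) unfolding claw_heavy_def by blast
    then have "bc_adj G x b \<or> bc_adj G x c" using n(3) bc_adj_local_completion[OF G] by blast
    \<comment> \<open>\<open>a\<close> inherits the heaviness of \<open>x\<close>: after completion
      it sees \<open>x\<close> and every other neighbour of \<open>x\<close>.\<close>
    moreover have "bc_adj ?G a y" if y: "bc_adj G x y" "\<not> adj G x y" "a \<noteq> y" for y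
    proof -
      have hx: "o_heavy_pair G x y" using y unfolding bc_adj_iff by blast
      have "degree G x \<le> degree ?G a"
      proof -
        have "insert x (nbhd G x - {a}) \<subseteq> nbhd ?G a"
          using w D(1) by (auto simp: nbhd_def local_completion_simps)
        then have "card (insert x (nbhd G x - {a})) \<le> degree ?G a"
          unfolding degree_def using D'(6) by (intro card_mono)
        moreover have "card (insert x (nbhd G x - {a})) = card (nbhd G x)"
        proof -
          have "x \<notin> nbhd G x" "a \<in> nbhd G x" using D(2) w by (auto simp: nbhd_def)
          then show ?thesis using D(6)[of x] by (metis card.remove card_insert_disjoint
                finite_Diff insert_Diff insert_iff)
        qed
        ultimately show ?thesis unfolding degree_def by simp
      qed
      moreover have "degree G y \<le> degree ?G y"
        unfolding degree_def using D'(6)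
        by (intro card_mono) (auto simp: nbhd_def local_completion_simps)
      moreover have "a \<in> pverts G" using w D(4) by blast
      ultimately show ?thesis
        using hx y(3) unfolding bc_adj_iff unfolding o_heavy_pair_def local_completion_simps by auto
    qed
    ultimately show False using n nx d by blast
  qed
  show ?thesis
    unfolding claw_heavy_def
  proof (intro allI impI, rule ccontr)
    fix w p q r
    assume e: "adj ?G w p" "adj ?G w q" "adj ?G w r" and d: "p \<noteq> q" "p \<noteq> r" "q \<noteq> r"
      and n: "\<not> (bc_adj ?G p q \<or> bc_adj ?G p r \<or> bc_adj ?G q r)"
    have n': "\<not> bc_adj ?G p q" "\<not> bc_adj ?G p r" "\<not> bc_adj ?G q r" "\<not> bc_adj ?G q p"
        "\<not> bc_adj ?G r p" "\<not> bc_adj ?G r q"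
      using n sym by blast+
    consider "adj G w p" "adj G w q" "adj G w r" | "adj G x w" "adj G x p" | "adj G x w" "adj G x q"
      | "adj G x w" "adj G x r"
      using e unfolding local_completion_simps by blast
    then show False
    proof cases
      case 1
      then have "bc_adj G p q \<or> bc_adj G p r \<or> bc_adj G q r" using cl d unfolding claw_heavy_def
          by blast
      then show False using n bc_adj_local_completion[OF G] by blast
    next
      case 2 then show False using new[OF 2 e(2,3) d(3) d(1,2)] n' by blast
    next
      case 3 then show False using new[OF 3 e(1,3) d(2) d(1)[symmetric] d(3)] n' by blast
    next
      case 4 then show False using new[OF 4 e(1,2) d(1) d(2)[symmetric] d(3)[symmetric]] n' by blast
    qed
  qed
qed

section \<open>Vertices that are not eligible\<close>

text \<open>Both sides of an uncrossed cut are cliques: two non-\<open>bc\<close> vertices on one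
  side and any vertex on the other would be leaves of a claw at \<open>x\<close>. So failing
  connectedness already yields two cliques, and ineligibility denies the vertex
  \<open>z\<close>.\<close>

lemma not_eligible_split:
  assumes G: "pair_graph G" and cl: "claw_heavy G" and el: "\<not> c_eligible G x"
    and uv: "adj G x u" "adj G x v" "u \<noteq> v" "\<not> adj G u v"
  obtains C1 C2 where "C1 \<union> C2 = nbhd G x" "C1 \<noteq> {}" "C2 \<noteq> {}"
    "\<forall>p\<in>C1. \<forall>q\<in>C1. p \<noteq> q \<longrightarrow> bc_adj G p q"
        "\<forall>p\<in>C2. \<forall>q\<in>C2. p \<noteq> q \<longrightarrow> bc_adj G p q"
    "\<forall>p\<in>C1. \<forall>q\<in>C2. \<not> bc_adj G p q \<and> \<not> bc_adj G q p \<and> p \<noteq> q"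
    "\<forall>z y1 y2. o_heavy_pair G x z \<longrightarrow> y1 \<in> C1 \<longrightarrow> y2 \<in> C2 \<longrightarrow> \<not> (adj G z y1 \<and> adj G z y2)"
proof -
  note D = pair_graphD[OF G]
  let ?N = "nbhd G x" and ?B = "bc_graph G x"
  have B: "adj ?B p q \<longleftrightarrow> bc_adj G p q" if "p \<in> ?N" "q \<in> ?N" for p q
    using that by (auto simp: bc_graph_def bc_adj_iff)
  have sym: "bc_adj G v u" if "bc_adj G u v" for u v
    using that D(1) by (auto simp: bc_adj_iff o_heavy_pair_def)
  have xV: "x \<in> pverts G" using uv D(3) by blast
  have nc: "\<not> is_clique G ?N" using uv by (auto simp: is_clique_def nbhd_def)
  then have "\<not> connected (with_proj ?B \<restriction> ?N)" using el xV unfolding c_eligible_def by blast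
  moreover have "?N \<noteq> {}" using uv by (auto simp: nbhd_def)
  ultimately obtain A where A: "A \<subseteq> ?N" "A \<noteq> {}" "A \<noteq> ?N" and cut:
      "\<And>p q. p \<in> A \<Longrightarrow> q \<in> ?N - A \<Longrightarrow> \<not> adj ?B p q"
    using not_connected_induce_cut by metis
  have cut': "\<not> bc_adj G p q" "\<not> bc_adj G q p" if "p \<in> A" "q \<in> ?N - A" for p q
    using cut[OF that] B[of p q] that A(1) sym by blast+
  have N: "adj G x p" if "p \<in> ?N" for p using that by (simp add: nbhd_def)
  have cliq: "bc_adj G p q"
    if X: "p \<in> X" "q \<in> X" "p \<noteq> q" "X = A \<and> Y = ?N - A \<or> X = ?N - A \<and> Y = A"
        for p q X Y
  proof -
    have "Y \<noteq> {}" using X(4) A by blast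
    then obtain s where s: "s \<in> Y" by blast
    have "\<not> bc_adj G p s" "\<not> bc_adj G q s" "s \<noteq> p" "s \<noteq> q" using X s cut' by blast+
    moreover have "p \<in> ?N" "q \<in> ?N" "s \<in> ?N" using X s A by blast+
    ultimately show ?thesis using cl N[of p] N[of q] N[of s] X(3) unfolding claw_heavy_def by blast
  qed
  have c1: "bc_adj G p q" if "p \<in> A" "q \<in> A" "p \<noteq> q" for p q using cliq that by blast
  have c2: "bc_adj G p q" if "p \<in> ?N - A" "q \<in> ?N - A" "p \<noteq> q" for p q using cliq that by blast
  have k1: "is_clique ?B A"
    unfolding is_clique_def using c1 B A(1) by (meson subsetD)
  have k2: "is_clique ?B (?N - A)"
    unfolding is_clique_def using c2 B by (meson DiffD1)
  have un: "A \<union> (?N - A) = ?N" "A \<inter> (?N - A) = {}" using A by blast+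
  have z: "\<not> (\<exists>z. o_heavy_pair G x z \<and> (\<exists>y1\<in>A. \<exists>y2\<in>?N - A. adj G z y1 \<and> adj G z y2))"
  proof
    assume z: "\<exists>z. o_heavy_pair G x z \<and> (\<exists>y1\<in>A. \<exists>y2\<in>?N - A. adj G z y1 \<and> adj G z y2)"
    have "c_eligible G x"
      unfolding c_eligible_def
      by (intro conjI xV nc disjI2 exI[of _ A] exI[of _ "?N - A"] un k1 k2 ballI cut z)
    then show False using el by blast
  qed
  show ?thesis
  proof (rule that[of A "?N - A"])
    show "A \<union> (?N - A) = ?N" "A \<noteq> {}" "?N - A \<noteq> {}" using A by blast+
    show "\<forall>p\<in>A. \<forall>q\<in>A. p \<noteq> q \<longrightarrow> bc_adj G p q" using c1 by blast
    show "\<forall>p\<in>?N - A. \<forall>q\<in>?N - A. p \<noteq> q \<longrightarrow> bc_adj G p q"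
        using c2 by blast
    show "\<forall>p\<in>A. \<forall>q\<in>?N - A. \<not> bc_adj G p q \<and> \<not> bc_adj G q p \<and> p \<noteq> q" using cut' by blast
    show "\<forall>z y1 y2. o_heavy_pair G x z \<longrightarrow> y1 \<in> A \<longrightarrow> y2 \<in> ?N - A \<longrightarrow> \<not> (adj G z y1 \<and> adj G z y2)"
      using z by blast
  qed
qed

text \<open>
  For an o-heavy pair \<open>a, b\<close> every common neighbour \<open>x\<close> has a private neighbour outside
  \<open>N(a) \<union> N(b)\<close>; there are too few such vertices, and a collision \<open>x, y\<close> makes
  \<open>a\<close> eligible with \<open>b\<close> as the vertex \<open>z\<close>.
\<close>

lemma closed_no_o_heavy_pair:
  assumes G: "pair_graph G" and cl: "claw_heavy G" and el: "\<And>x. \<not> c_eligible G x"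
  shows "\<not> o_heavy_pair G a b"
proof
  assume ab: "o_heavy_pair G a b"
  note D = pair_graphD[OF G]
  have sym: "bc_adj G v u" if "bc_adj G u v" for u v
    using that D(1) by (auto simp: bc_adj_iff o_heavy_pair_def)
  have ab': "a \<noteq> b" "\<not> adj G a b" "a \<in> pverts G" "b \<in> pverts G" and bab: "bc_adj G a b"
    using ab by (auto simp: o_heavy_pair_def bc_adj_iff)
  let ?A = "nbhd G a" and ?B = "nbhd G b"
  let ?K = "?A \<inter> ?B" and ?R = "pverts G - (?A \<union> ?B)"
  have "\<exists>c. c \<in> ?R - {a, b} \<and> adj G x c \<and> (\<forall>y. adj G y a \<longrightarrow> adj G y c \<longrightarrow> y \<noteq> x \<longrightarrow> \<not> bc_adj G x y)"
    if x: "x \<in> ?K" for x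
  proof -
    have xab: "adj G x a" "adj G x b" using x D(1) by (auto simp: nbhd_def)
    obtain C1 C2 where C: "C1 \<union> C2 = nbhd G x" "C1 \<noteq> {}" "C2 \<noteq> {}"
      "\<forall>p\<in>C1. \<forall>q\<in>C1. p \<noteq> q \<longrightarrow> bc_adj G p q"
          "\<forall>p\<in>C2. \<forall>q\<in>C2. p \<noteq> q \<longrightarrow> bc_adj G p q"
      "\<forall>p\<in>C1. \<forall>q\<in>C2. \<not> bc_adj G p q \<and> \<not> bc_adj G q p \<and> p \<noteq> q"
      "\<forall>z y1 y2. o_heavy_pair G x z \<longrightarrow> y1 \<in> C1 \<longrightarrow> y2 \<in> C2 \<longrightarrow> \<not> (adj G z y1 \<and> adj G z y2)"
      using not_eligible_split[OF G cl el xab ab'(1,2)] .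
    have key: "\<exists>c. c \<in> ?R - {a, b} \<and> adj G x c \<and> (\<forall>y. adj G y a \<longrightarrow> adj G y c \<longrightarrow> y \<noteq> x \<longrightarrow> \<not> bc_adj G x y)"
      if E: "E1 \<union> E2 = nbhd G x" "E2 \<noteq> {}" "a \<in> E1" "b \<in> E1"
        "\<forall>p\<in>E1. \<forall>q\<in>E2. \<not> bc_adj G p q \<and> \<not> bc_adj G q p \<and> p \<noteq> q"
        "\<forall>z y1 y2. o_heavy_pair G x z \<longrightarrow> y1 \<in> E1 \<longrightarrow> y2 \<in> E2 \<longrightarrow> \<not> (adj G z y1 \<and> adj G z y2)" for E1 E2
    proof -
      obtain c where c: "c \<in> E2" using E by blast
      have xc: "adj G x c" using c E(1) by (auto simp: nbhd_def)
      have "c \<in> ?R - {a, b}"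
        using E(3,4,5) c D(4)[OF xc] by (auto simp: nbhd_def bc_adj_iff)
      \<comment> \<open>An adjacent \<open>y\<close> would lie in one of the cliques and join it to
        the other through \<open>a\<close> or \<open>c\<close>; an o-heavy partner \<open>y\<close>
        would be the vertex \<open>z\<close> making \<open>x\<close> eligible.\<close>
      moreover have "\<not> bc_adj G x y" if y: "adj G y a" "adj G y c" "y \<noteq> x" for y
      proof
        assume "bc_adj G x y"
        then consider "adj G x y" | "o_heavy_pair G x y" unfolding bc_adj_iff by blast
        then show False
        proof cases
          case 1
          then have "y \<in> E1 \<or> y \<in> E2" using E(1) by (auto simp: nbhd_def)
          moreover have "bc_adj G y c" "bc_adj G y a" using y by (auto simp: bc_adj_iff)
          ultimately show False using E(3,5) c by blast
        next
          case 2 then show False using E(3,6) c y by blast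
        qed
      qed
      ultimately show ?thesis using xc by blast
    qed
    have "a \<in> C1 \<union> C2" "b \<in> C1 \<union> C2" using C(1) xab by (auto simp: nbhd_def)
    then consider "a \<in> C1" "b \<in> C1" | "a \<in> C2" "b \<in> C2" using C(6) bab by blast
    then show ?thesis
    proof cases
      case 1 then show ?thesis using key[OF C(1,3) 1 C(6,7)] by blast
    next
      case 2
      have "C2 \<union> C1 = nbhd G x" using C(1) by blast
      then show ?thesis using key[OF _ C(2) 2] C(6,7) by blast
    qed
  qed
  then obtain f where f: "\<And>x. x \<in> ?K \<Longrightarrow> f x \<in> ?R - {a, b} \<and> adj G x (f x) \<and>
      (\<forall>y. adj G y a \<longrightarrow> adj G y (f x) \<longrightarrow> y \<noteq> x \<longrightarrow> \<not> bc_adj G x y)"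
    by metis
  \<comment> \<open>Heaviness gives \<open>card ?R <= card ?K\<close>, but the values of
    \<open>f\<close> also avoid \<open>a\<close> and \<open>b\<close>, which are in
    \<open>?R\<close>.\<close>
  have "\<not> inj_on f ?K"
  proof
    assume "inj_on f ?K"
    then have "card ?K \<le> card (?R - {a, b})"
      using f D(5) by (intro card_inj_on_le[of f]) auto
    moreover have "{a, b} \<subseteq> ?R" using ab' D(1,2) by (auto simp: nbhd_def)
    then have "card (?R - {a, b}) = card ?R - 2" "card ?R \<ge> 2"
      using ab'(1) D(5) card_mono[of ?R "{a, b}"] by (auto simp: card_Diff_subset)
    moreover have "?A \<union> ?B \<subseteq> pverts G" using D(4) by (auto simp: nbhd_def)
    then have "card ?R = card (pverts G) - card (?A \<union> ?B)"
        "card (?A \<union> ?B) \<le> card (pverts G)"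
      using D(5,6) by (auto intro!: card_Diff_subset card_mono)
    moreover have "card ?A + card ?B = card (?A \<union> ?B) + card ?K"
      using card_Un_Int D(6) by blast
    moreover have "card (pverts G) \<le> card ?A + card ?B"
      using ab by (simp add: o_heavy_pair_def degree_def)
    ultimately show False by linarith
  qed
  then obtain x y where xy: "x \<in> ?K" "y \<in> ?K" "x \<noteq> y" "f x = f y" unfolding inj_on_def by blast
  have ax: "adj G a x" "adj G a y" "adj G b x" "adj G b y" using xy by (auto simp: nbhd_def)
  have nb: "\<not> bc_adj G x y" using f[OF xy(1)] f[OF xy(2)] xy(3,4) D(1)[OF ax(2)] by metis
  then have na: "\<not> bc_adj G y x" "\<not> adj G x y" using sym unfolding bc_adj_iff by blast+
  obtain C1 C2 where C: "C1 \<union> C2 = nbhd G a" "C1 \<noteq> {}" "C2 \<noteq> {}"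
      "\<forall>p\<in>C1. \<forall>q\<in>C1. p \<noteq> q \<longrightarrow> bc_adj G p q"
          "\<forall>p\<in>C2. \<forall>q\<in>C2. p \<noteq> q \<longrightarrow> bc_adj G p q"
      "\<forall>p\<in>C1. \<forall>q\<in>C2. \<not> bc_adj G p q \<and> \<not> bc_adj G q p \<and> p \<noteq> q"
      "\<forall>z y1 y2. o_heavy_pair G a z \<longrightarrow> y1 \<in> C1 \<longrightarrow> y2 \<in> C2 \<longrightarrow> \<not> (adj G z y1 \<and> adj G z y2)"
    using not_eligible_split[OF G cl el ax(1,2) xy(3) na(2)] .
  have "x \<in> C1 \<union> C2" "y \<in> C1 \<union> C2" using C(1) ax by (auto simp: nbhd_def)
  then consider "x \<in> C1" "y \<in> C2" | "y \<in> C1" "x \<in> C2" using C(4,5) nb xy(3) by blast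
  then show False using C(7) ab ax by cases blast+
qed

section \<open>From the closure to the relational setting\<close>

lemma c_step_invariants:
  assumes "c_step\<^sup>*\<^sup>* G H" "pair_graph G" "claw_heavy G"
  shows "pair_graph H" "claw_heavy H" "pverts H = pverts G" "parcs G \<subseteq> parcs H"
proof -
  have "pair_graph H \<and> claw_heavy H \<and> pverts H = pverts G \<and> parcs G \<subseteq> parcs H"
    using assms
  proof (induction rule: rtranclp_induct)
    case base then show ?case by simp
  next
    case (step H H')
    then obtain x where H': "H' = local_completion H x" by (auto simp: c_step_def)
    have IH: "pair_graph H" "claw_heavy H" "pverts H = pverts G" "parcs G \<subseteq> parcs H"
      using step by blast+
    have "parcs H \<subseteq> parcs H'" unfolding H' local_completion_def by auto
    with IH(4) have "parcs G \<subseteq> parcs H'" by (rule subset_trans)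
    moreover have "pair_graph H'" unfolding H' using pair_graph_local_completion[OF IH(1)] .
    moreover have "claw_heavy H'" unfolding H' using claw_heavy_local_completion[OF IH(1,2)] .
    moreover have "pverts H' = pverts G" unfolding H' local_completion_simps(1) using IH(3) .
    ultimately show ?case by (intro conjI)
  qed
  then show "pair_graph H" "claw_heavy H" "pverts H = pverts G" "parcs G \<subseteq> parcs H" by blast+
qed

text \<open>Going back from \<open>H\<close>, a crossing edge \<open>u\<close>, \<open>v\<close>
  added at \<open>x\<close> can be replaced: \<open>x\<close> has two neighbours in the region,
  hence lies in it, and one of its old edges to \<open>u\<close> and \<open>v\<close> crosses the
  cut.\<close>

lemma c_closure_region_cut:
  assumes "c_step\<^sup>*\<^sup>* G H" "pair_graph G" "claw_heavy G"
    and C: "region (adj H) C" and A: "A \<subseteq> C" "A \<noteq> {}" "A \<noteq> C"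
  shows "\<exists>x\<in>A. \<exists>y\<in>C - A. adj G x y"
  using assms(1-3)
proof (induction rule: converse_rtranclp_induct)
  case base
  obtain u v where "u \<in> A" "v \<in> C - A" using A by blast
  moreover from this have "u \<in> C" "v \<in> C" "u \<noteq> v" using A by auto
  then have "adj H u v" using C[unfolded region_def] by metis
  ultimately show ?case by blast
next
  case (step G G')
  then obtain x where x: "G' = local_completion G x" by (auto simp: c_step_def)
  have G': "pair_graph G'" "claw_heavy G'"
    unfolding x using pair_graph_local_completion[OF step.prems(1)]
      claw_heavy_local_completion[OF step.prems] by simp_all
  note D = pair_graphD[OF step.prems(1)]
  obtain u v where uv: "u \<in> A" "v \<in> C - A" "adj G' u v" using step.IH[OF G'] by blast
  show ?case
  proof (cases "adj G u v")
    case True then show ?thesis using uv by blast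
  next
    case False
    then have xuv: "adj G x u" "adj G x v" using uv unfolding x local_completion_simps by blast+
    moreover have "parcs G \<subseteq> parcs H"
      using c_step_invariants(4)[OF converse_rtranclp_into_rtranclp[OF step.hyps] step.prems] .
    ultimately have "adj H x u" "adj H x v" by blast+
    moreover have "u \<noteq> v" "u \<in> C" "v \<in> C" using uv A by blast+
    ultimately have xC: "x \<in> C" using C[unfolded region_def] by metis
    show ?thesis
    proof (cases "x \<in> A")
      case True then show ?thesis using uv(2) xuv(2) by blast
    next
      case False then show ?thesis using uv(1) D(1)[OF xuv(1)] xC by blast
    qed
  qed
qed

lemma c_closure_pair:
  fixes G H :: "'a pair_pre_digraph"
  assumes G: "pair_graph G" and two: "two_connected G" and claw: "H_o_heavy claw G"
    and W: "H_o_heavy wounded G" and cl: "is_c_closure G H"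
  shows "closure_pair (pverts H) (adj G) (adj H)"
proof -
  have st: "c_step\<^sup>*\<^sup>* G H" and el: "\<And>x. \<not> c_eligible H x" using cl
      by (auto simp: is_c_closure_def)
  note cG = claw_heavyI[OF G claw]
  note inv = c_step_invariants[OF st G cG]
  note DG = pair_graphD[OF G]
  note DH = pair_graphD[OF inv(1)]
  note nh = closed_no_o_heavy_pair[OF inv(1,2) el]
  have bH: "bc_adj H u v \<longleftrightarrow> adj H u v" for u v using nh by (simp add: bc_adj_iff)
  show ?thesis
  proof unfold_locales
    show "finite (pverts H)" by (rule DH(5))
    show "adj H u v" if "adj G u v" for u v using that inv(4) by blast
    show "adj G v u" if "adj G u v" for u v using that DG(1) by blast
    show "adj H v u" if "adj H u v" for u v using that DH(1) by blast
    show "\<not> adj H u u" for u by (rule DH(2))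
    show "u \<in> pverts H" if "adj H u v" for u v using that DH(3) by blast
    show "adj_or_heavy (pverts H) (adj G) p q \<or> adj_or_heavy (pverts H) (adj G) p r \<or>
      adj_or_heavy (pverts H) (adj G) q r"
      if "adj G x p" "adj G x q" "adj G x r" "p \<noteq> q" "p \<noteq> r" "q \<noteq> r" for x p q r
      using cG that unfolding inv(3) claw_heavy_def by blast
    show "adj_or_heavy (pverts H) (adj G) x p \<or> adj_or_heavy (pverts H) (adj G) x q \<or>
      adj_or_heavy (pverts H) (adj G) x r \<or> adj_or_heavy (pverts H) (adj G) y q \<or>
      adj_or_heavy (pverts H) (adj G) y r \<or> adj_or_heavy (pverts H) (adj G) z p \<or>
      adj_or_heavy (pverts H) (adj G) z r \<or> adj_or_heavy (pverts H) (adj G) p q \<or>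
      adj_or_heavy (pverts H) (adj G) p r"
      if "adj G x y" "adj G y z" "adj G x z" "adj G y p" "adj G z q" "adj G q r" for x y z p q r
      using wounded_heavyI[OF G W that] unfolding inv(3) .
    show "\<not> heavy_nonadj (pverts H) (adj H) u v" for u v
      unfolding heavy_nonadj_adj by (rule nh)
    show "adj H p q \<or> adj H p r \<or> adj H q r"
      if "adj H x p" "adj H x q" "adj H x r" "p \<noteq> q" "p \<noteq> r" "q \<noteq> r" for x p q r
      using inv(2) that unfolding claw_heavy_def bH by blast
    show "adj H u v" if e: "adj H x y" "adj H u x" "adj H u y" "adj H v x" "adj H v y" "u \<noteq> v"
        for x y u v
    proof (rule ccontr)
      \<comment> \<open>The ineligible \<open>x\<close> would split its neighbourhood into two
        cliques with no edge between them, \<open>u\<close> and \<open>v\<close> in different ones,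
        although \<open>y\<close> is adjacent to both.\<close>
      assume n: "\<not> adj H u v"
      have e': "adj H x u" "adj H x v" "adj H y v" using e DH(1) by blast+
      obtain C1 C2 where C: "C1 \<union> C2 = nbhd H x" "C1 \<noteq> {}" "C2 \<noteq> {}"
      "\<forall>p\<in>C1. \<forall>q\<in>C1. p \<noteq> q \<longrightarrow> bc_adj H p q"
          "\<forall>p\<in>C2. \<forall>q\<in>C2. p \<noteq> q \<longrightarrow> bc_adj H p q"
      "\<forall>p\<in>C1. \<forall>q\<in>C2. \<not> bc_adj H p q \<and> \<not> bc_adj H q p \<and> p \<noteq> q"
      "\<forall>z y1 y2. o_heavy_pair H x z \<longrightarrow> y1 \<in> C1 \<longrightarrow> y2 \<in> C2 \<longrightarrow> \<not> (adj H z y1 \<and> adj H z y2)"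
        using not_eligible_split[OF inv(1,2) el e'(1,2) e(6) n] .
      have "u \<in> C1 \<union> C2" "v \<in> C1 \<union> C2" "y \<in> C1 \<union> C2" using C(1) e e'
          by (auto simp: nbhd_def)
      then show False using C(4,5,6) e(3,6) e'(3) n unfolding bH by blast
    qed
    show "\<exists>x\<in>A. \<exists>y\<in>C - A. adj G x y" if "region (adj H) C" "A \<subseteq> C"
        "A \<noteq> {}" "A \<noteq> C" for C A
      using c_closure_region_cut[OF st G cG that] .
    show "\<exists>x\<in>S. \<exists>y\<in>pverts H - {v} - S. adj G x y"
      if v: "v \<in> pverts H" and S: "S \<subseteq> pverts H - {v}" "S \<noteq> {}"
          "S \<noteq> pverts H - {v}" for v S
    proof -
      have "connected (with_proj G \<restriction> (pverts H - {v}))"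
        using two v unfolding two_connected_def inv(3) by blast
      then show ?thesis using connected_induce_cut[OF _ DG(1) S] by blast
    qed
  qed
qed

section \<open>Back to induced claws and nets\<close>

lemma claw_freeI:
  assumes "\<And>x p q r. adj H x p \<Longrightarrow> adj H x q \<Longrightarrow> adj H x r \<Longrightarrow> p \<noteq> q \<Longrightarrow> p \<noteq> r \<Longrightarrow> q \<noteq> r \<Longrightarrow>
    adj H p q \<or> adj H p r \<or> adj H q r"
  shows "H_free claw H"
  unfolding H_free_def
proof
  assume "\<exists>S\<subseteq>pverts H. digraph_iso (with_proj claw) (with_proj H \<restriction> S)"
  then obtain f where f: "induced_embedding f claw H"
    using digraph_iso_induce_iff[OF pair_wf_claw] by blast
  have V: "(0::nat) \<in> pverts claw" "(1::nat) \<in> pverts claw" "(2::nat) \<in> pverts claw"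
      "(3::nat) \<in> pverts claw"
    by (auto simp: claw_def from_edges_def)
  have arcs: "adj H (f i) (f j) \<longleftrightarrow> adj claw i j" if "i \<in> pverts claw"
      "j \<in> pverts claw" for i j
    using f that unfolding induced_embedding_def by blast
  have neq: "f i \<noteq> f j" if "i \<in> pverts claw" "j \<in> pverts claw" "i \<noteq> j" for i j
    using f that unfolding induced_embedding_def inj_on_def by blast
  show False
    using assms[of "f 0" "f 1" "f 2" "f 3"] arcs[OF V(1,2)] arcs[OF V(1,3)] arcs[OF V(1,4)]
      arcs[OF V(2,3)] arcs[OF V(2,4)] arcs[OF V(3,4)] neq[OF V(2,3)] neq[OF V(2,4)] neq[OF V(3,4)]
    by (simp add: claw_def from_edges_def)
qed

lemma index_triple_iff:
  "index_triple i j k \<longleftrightarrow> i \<in> {1, 2, 3} \<and> j \<in> {1, 2, 3} \<and> k \<in> {1, 2, 3} \<and> i \<noteq> j \<and> i \<noteq> k \<and> j \<noteq> k"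
proof
  assume t: "index_triple i j k"
  have "card {i, j, k} = 3" using t by (simp add: index_triple_def)
  then have "i \<noteq> j \<and> i \<noteq> k \<and> j \<noteq> k"
      by (auto simp: card_insert_if split: if_splits)
  then show "i \<in> {1, 2, 3} \<and> j \<in> {1, 2, 3} \<and> k \<in> {1, 2, 3} \<and> i \<noteq> j \<and> i \<noteq> k \<and> j \<noteq> k"
    using t unfolding index_triple_def by blast
next
  assume "i \<in> {1, 2, 3} \<and> j \<in> {1, 2, 3} \<and> k \<in> {1, 2, 3} \<and> i \<noteq> j \<and> i \<noteq> k \<and> j \<noteq> k"
  then show "index_triple i j k" unfolding index_triple_def by auto
qed

theorem theorem12:
  fixes G H :: "'a pair_pre_digraph"
  assumes "pair_graph G"
    and "two_connected G"
    and "H_o_heavy claw G"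
    and "H_o_heavy wounded G"
    and "is_c_closure G H"
  shows "H_free claw H \<and> N_pq_heavy H"
proof
  interpret cp: closure_pair "pverts H" "adj G" "adj H"
    using c_closure_pair[OF assms] .
  show "H_free claw H" using claw_freeI cp.claw_h by metis
  show "N_pq_heavy H"
    unfolding N_pq_heavy_def
  proof (intro allI impI)
    fix a b :: "nat \<Rightarrow> 'a"
    assume net: "induced_net H a b"
    have emb: "induced_embedding (case_sum a b) net H" using net by (simp add: induced_net_def)
    have arcs: "adj H (case_sum a b s) (case_sum a b t) \<longleftrightarrow> adj net s t"
      if "s \<in> pverts net" "t \<in> pverts net" for s t
      using emb that unfolding induced_embedding_def by blast
    have neq: "case_sum a b s \<noteq> case_sum a b t" if "s \<in> pverts net" "t \<in> pverts net"
        "s \<noteq> t" for s t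
      using emb that unfolding induced_embedding_def inj_on_def by blast
    have V: "Inl i \<in> pverts net" "Inr i \<in> pverts net" if "i \<in> {1, 2, 3}" for i
      using that by (auto simp: net_def from_edges_def)
    have aV: "a i \<in> pverts H" "b i \<in> pverts H" if "i \<in> {1, 2, 3}" for i
      using emb V[OF that] unfolding induced_embedding_def by force+
    show "p_heavy_net H a b \<or> q_heavy_net H a b"
    proof (rule disjCI)
      assume nq: "\<not> q_heavy_net H a b"
      show "p_heavy_net H a b"
      proof (rule ccontr)
        assume np: "\<not> p_heavy_net H a b"
        have ha: "adj H (a i) (a j)" if "index_triple i j k" for i j k
          using arcs[of "Inl i" "Inl j"] V that unfolding index_triple_iff
          by (auto simp: net_def from_edges_def)
        have nl: "light_net (pverts H) (adj G) (adj H) a b"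
        proof (intro light_net.intro c_closure_pair[OF assms] light_net_axioms.intro)
          fix i j k assume t: "index_triple i j k"
          have ij: "i \<in> {1, 2, 3}" "j \<in> {1, 2, 3}" "i \<noteq> j" using t
              unfolding index_triple_iff by blast+
          show "adj H (a i) (a j)" using ha t .
          show "adj H (a i) (b i)"
            using arcs[OF V(1,2)[OF ij(1)]] ij by (auto simp: net_def from_edges_def)
          show "\<not> adj H (a i) (b j)"
            using arcs[OF V(1)[OF ij(1)] V(2)[OF ij(2)]] ij by (auto simp: net_def from_edges_def)
          show "\<not> adj H (b i) (b j)"
            using arcs[OF V(2)[OF ij(1)] V(2)[OF ij(2)]] ij by (auto simp: net_def from_edges_def)
          show "a i \<noteq> b j" using neq[OF V(1)[OF ij(1)] V(2)[OF ij(2)]] by simp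
          show "b i \<noteq> b j" using neq[OF V(2)[OF ij(1)] V(2)[OF ij(2)]] ij by simp
          show "card {w. adj H (a i) w} + card {w. adj H (a j) w} < card (pverts H)"
            using np ij ha[OF t] unfolding p_heavy_net_def a_heavy_pair_def degree_def nbhd_def
            by (meson not_le)
        qed
        obtain i j k where t: "index_triple i j k"
          and hk: "card (pverts H) \<le> 2 * card {w. adj H (a k) w}"
              "card (pverts H) \<le> 2 * card {w. adj H (b k) w}"
          and m: "\<forall>m\<in>{i, j}. card {w. adj H (a m) w} = 3 \<and> card {w. adj H (b m) w} = 2 \<and>
            (\<forall>x. adj H (b m) x \<longrightarrow> x \<noteq> a m \<longrightarrow> card (pverts H) \<le> 2 * card {w. adj H x w})"
          using light_net.net_q_heavy[OF nl] by blast
        have k: "k \<in> {1, 2, 3}" "{1, 2, 3} - {k} = {i, j}"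
          using t unfolding index_triple_iff by auto
        have "q_heavy_net H a b"
          unfolding q_heavy_net_def
        proof (intro bexI[OF _ k(1)] conjI ballI)
          show "heavy H (a k)" "heavy H (b k)"
            using hk aV[OF k(1)] by (simp_all add: heavy_def degree_def nbhd_def)
        next
          fix l assume "l \<in> {1, 2, 3} - {k}"
          then have l: "l \<in> {i, j}" using k(2) by blast
          show "degree H (a l) = 3" "degree H (b l) = 2"
            using m l unfolding degree_def nbhd_def by blast+
          fix w assume "w \<in> nbhd H (b l) - {a l}"
          then have w: "adj H (b l) w" "w \<noteq> a l" by (auto simp: nbhd_def)
          then show "heavy H w"
            using m l cp.h_V[OF cp.h_sym[OF w(1)]] unfolding heavy_def degree_def nbhd_def by blast
        qed
        then show False using nq by blast
      qed
    qed
  qed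
qed

end
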